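(* If $q>2$ and $d_q$ is the distance function on $\mathbb{R}^n$ induced by the $l_q$-norm $N_q(x)=\left(\sum_{i=1}^n|x_i|^q\right)^{1/q}$, then the Wasserstein space $\mathcal{W}_2(\mathbb{R}^n,d_q)$ is isometrically rigid.
   Context: $d_q(x,y)=N_q(x-y)$. For a complete separable metric space $(X,d_X)$ and $p\ge 1$, $\mathcal{W}_p(X,d_X)$ is the set of Borel probability measures $\mu$ on $X$ with $\int_X d_X^p(x,x_0)\,d\mu(x)<\infty$ for some (hence any) $x_0\in X$, equipped with the distance $d_{\mathcal{W}_p}(\mu,\nu)=\inf_{\pi\in\Pi(\mu,\nu)}\left(\iint_{X\times X} d_X^p(x,y)\,d\pi(x,y)\right)^{1/p}$, where $\Pi(\mu,\nu)$ is the set of couplings of $\mu$ and $\nu$. An isometry is a distance-preserving bijection of a metric space onto itself. For a map $\phi$, the push-forward is $\phi_{\#}\mu(A)=\mu(\phi^{-1}(A))$. If $\phi$ is an isometry of $(X,d_X)$, then $\phi_\#$ is an isometry of $\mathcal{W}_p(X,d_X)$; isometries of this form are called trivial. $\mathcal{W}_p(X,d_X)$ is isometrically rigid if every isometry $\Phi$ of $\mathcal{W}_p(X,d_X)$ equals $\phi_\#$ for some isometry $\phi$ of $(X,d_X)$.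
   Formalization: The dimension is assumed to be n ≥ 2: for n = 1 every N_q is the absolute value, and reflecting each measure about its centre of mass is a non-trivial isometry of W_2(R), so the claim fails there. *)

theory Defs
  imports "HOL-Probability.Probability"
begin

definition metric_borel :: "'a set \<Rightarrow> ('a \<Rightarrow> 'a \<Rightarrow> real) \<Rightarrow> 'a measure"
  where "metric_borel X d = sigma X {U. openin (Metric_space.mtopology X d) U}"

definition wasserstein_space :: "real \<Rightarrow> 'a set \<Rightarrow> ('a \<Rightarrow> 'a \<Rightarrow> real) \<Rightarrow> 'a measure set"
  where "wasserstein_space p X d =
    {\<mu>. prob_space \<mu> \<and> sets \<mu> = sets (metric_borel X d) \<and>
         (\<exists>x0\<in>X. (\<integral>\<^sup>+ x. ennreal (d x x0 powr p) \<partial>\<mu>) < \<infinity>)}"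

definition couplings :: "'a measure \<Rightarrow> 'a measure \<Rightarrow> ('a \<times> 'a) measure set"
  where "couplings \<mu> \<nu> =
    {\<pi>. prob_space \<pi> \<and> sets \<pi> = sets (\<mu> \<Otimes>\<^sub>M \<nu>) \<and>
         distr \<pi> \<mu> fst = \<mu> \<and> distr \<pi> \<nu> snd = \<nu>}"

(* For a separable metric space, d is measurable with respect to the product sigma-algebra,
   and for \<mu>, \<nu> in wasserstein_space p X d with p \<ge> 1 every coupling has finite cost and the
   set of couplings is nonempty. On that domain neither the Bochner integral nor the real
   infimum therefore takes a default value. *)
definition wasserstein_dist ::
  "real \<Rightarrow> ('a \<Rightarrow> 'a \<Rightarrow> real) \<Rightarrow> 'a measure \<Rightarrow> 'a measure \<Rightarrow> real"
  where "wasserstein_dist p d \<mu> \<nu> =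
    (INF \<pi>\<in>couplings \<mu> \<nu>. (\<integral>(x, y). d x y powr p \<partial>\<pi>) powr (1 / p))"

definition isometry_of :: "'a set \<Rightarrow> ('a \<Rightarrow> 'a \<Rightarrow> real) \<Rightarrow> ('a \<Rightarrow> 'a) \<Rightarrow> bool"
  where "isometry_of X d \<phi> \<longleftrightarrow>
    bij_betw \<phi> X X \<and> (\<forall>x\<in>X. \<forall>y\<in>X. d (\<phi> x) (\<phi> y) = d x y)"

(* The action of \<Phi> outside the Wasserstein space and of \<phi> outside X is irrelevant. *)
definition isometrically_rigid :: "real \<Rightarrow> 'a set \<Rightarrow> ('a \<Rightarrow> 'a \<Rightarrow> real) \<Rightarrow> bool"
  where "isometrically_rigid p X d \<longleftrightarrow>
    (\<forall>\<Phi>. isometry_of (wasserstein_space p X d) (wasserstein_dist p d) \<Phi> \<longrightarrow>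
      (\<exists>\<phi>. isometry_of X d \<phi> \<and>
        (\<forall>\<mu>\<in>wasserstein_space p X d. \<Phi> \<mu> = distr \<mu> (metric_borel X d) \<phi>)))"

definition lq_norm :: "real \<Rightarrow> real ^ 'n \<Rightarrow> real"
  where "lq_norm q x = (\<Sum>i\<in>UNIV. \<bar>x $ i\<bar> powr q) powr (1 / q)"

definition lq_dist :: "real \<Rightarrow> real ^ 'n \<Rightarrow> real ^ 'n \<Rightarrow> real"
  where "lq_dist q x y = lq_norm q (x - y)"

end

theory Submission
  imports Defs
begin

text \<open>
  Dirac measures are the points of the Wasserstein space from which every segment can be prolonged to
  twice its length, so an isometry \<open>\<Phi>\<close> permutes them through an isometry \<open>\<phi>\<close> of the underlying space.
  Distances to Dirac measures are then preserved, which means that \<open>\<mu>\<close> and the pull-back of \<open>\<Phi> \<mu>\<close>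
  under \<open>\<phi>\<close> have the same potential \<open>x \<mapsto> \<integral> N (x - y)\<^sup>2 d\<mu> y\<close>.

  The potential determines the atoms. For \<open>q > 2\<close> the square of the \<open>l\<^sub>q\<close> norm is twice continuously
  differentiable away from the origin, with second derivatives that are homogeneous of degree \<open>0\<close>.
  Hence a second difference along one axis, differenced once more along another axis, gives a function
  \<open>K\<close> that vanishes at infinity while \<open>K 0 = 4 - 2 powr (1 + 2 / q) > 0\<close>. The potential
  determines \<open>\<integral> K (k (x - y)) d\<mu> y\<close> for every \<open>k\<close>, and this tends to \<open>K 0\<close> times the mass of the
  atom at \<open>x\<close>. So \<open>\<Phi>\<close> is the push-forward on countably supported measures, which are dense.
\<close>

section \<open>Preliminaries on probability measures\<close>

lemma real_square_sum_le: "((a::real) + b)\<^sup>2 \<le> 2 * a\<^sup>2 + 2 * b\<^sup>2"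
proof -
  have "2 * a\<^sup>2 + 2 * b\<^sup>2 - (a + b)\<^sup>2 = (a - b)\<^sup>2" by (simp add: power2_eq_square algebra_simps)
  then show ?thesis using zero_le_power2[of "a - b"] by linarith
qed

text \<open>Nonnegativity of the variance. \<open>W_Lipschitz\<close> uses it to pass from the mean
  displacement of a coupling to the root of its quadratic cost.\<close>

lemma (in prob_space) square_expectation_le:
  fixes X :: "'a \<Rightarrow> real"
  assumes [measurable]: "X \<in> borel_measurable M" and "integrable M (\<lambda>x. (X x)\<^sup>2)"
  shows "integrable M X" and "(expectation X)\<^sup>2 \<le> expectation (\<lambda>x. (X x)\<^sup>2)"
proof -
  show int: "integrable M X"
  proof (rule Bochner_Integration.integrable_bound)
    show "integrable M (\<lambda>x. 1 + (X x)\<^sup>2)" using assms by simp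
    have "\<bar>t\<bar> \<le> 1 + t\<^sup>2" for t :: real
      using zero_le_power2[of "\<bar>t\<bar> - 1"] zero_le_power2[of t] by (simp add: power2_diff)
    then show "AE x in M. norm (X x) \<le> norm (1 + (X x)\<^sup>2)" by (simp add: order_trans[OF _ abs_ge_self])
  qed simp
  have "0 \<le> variance X" by (rule variance_positive)
  then show "(expectation X)\<^sup>2 \<le> expectation (\<lambda>x. (X x)\<^sup>2)" by (subst (asm) variance_eq[OF int assms(2)]) simp
qed

lemma prob_measure_eq_return:
  fixes M :: "'a::t1_space measure"
  assumes "prob_space M" and M: "sets M = sets borel" and "AE y in M. y = x"
  shows "M = return borel x"
proof (rule measure_eqI)
  interpret prob_space M by fact
  show "sets M = sets (return borel x)" using M by simp
  fix A assume A: "A \<in> sets M"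
  have "emeasure M A = emeasure M (if x \<in> A then space M else {})"
    by (rule emeasure_eq_AE) (use assms(3) A in auto)
  then show "emeasure M A = emeasure (return borel x) A"
    using A M by (auto simp: emeasure_space_1)
qed

text \<open>Countable additivity turns equality of atoms into equality on all subsets of
  \<open>S\<close>. In particular \<open>\<nu>\<close> has mass 1 on \<open>S\<close>, so it is
  carried by \<open>S\<close> too although only \<open>\<mu>\<close> is assumed to be, and both
  measures are determined by their traces on \<open>S\<close>.\<close>

lemma prob_measures_eqI_atoms:
  fixes \<mu> \<nu> :: "'a::t1_space measure"
  assumes \<mu>: "prob_space \<mu>" "sets \<mu> = sets borel" and \<nu>: "prob_space \<nu>" "sets \<nu> = sets borel"
    and S: "countable S" "AE x in \<mu>. x \<in> S"
    and eq: "\<And>x. measure \<mu> {x} = measure \<nu> {x}"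
  shows "\<mu> = \<nu>"
proof -
  interpret M: prob_space \<mu> by fact
  interpret N: prob_space \<nu> by fact
  have sub: "B \<in> sets borel" if "B \<subseteq> S" for B
    using countable_subset[OF that S(1)]
    by (rule sets.countable[rotated]) auto
  have cnt: "emeasure \<mu> B = emeasure \<nu> B" if "B \<subseteq> S" for B
  proof -
    have "emeasure \<mu> B = (\<integral>\<^sup>+x. emeasure \<mu> {x} \<partial>count_space B)"
      using countable_subset[OF that S(1)] by (intro emeasure_countable_singleton) (auto simp: \<mu>)
    also have "\<dots> = (\<integral>\<^sup>+x. emeasure \<nu> {x} \<partial>count_space B)"
      by (simp add: M.emeasure_eq_measure N.emeasure_eq_measure eq)
    also have "\<dots> = emeasure \<nu> B"
      using countable_subset[OF that S(1)] by (intro emeasure_countable_singleton[symmetric]) (auto simp: \<nu>)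
    finally show ?thesis .
  qed
  have "emeasure \<mu> S = 1"
    using S(2) sub[of S] by (subst M.emeasure_eq_1_AE) (auto simp: \<mu>)
  then have "emeasure \<nu> S = 1" using cnt by simp
  then have S': "AE x in \<nu>. x \<in> S"
    using sub[of S] by (subst N.AE_in_set_eq_1) (auto simp: \<nu> N.emeasure_eq_measure)
  have S_sets: "S \<in> sets borel" by (rule sub) simp
  show ?thesis
  proof (rule measure_eqI)
    fix A assume "A \<in> sets \<mu>"
    then have A: "A \<in> sets borel" by (simp add: \<mu>)
    have "emeasure \<mu> A = emeasure \<mu> (A \<inter> S)"
      by (rule emeasure_eq_AE) (use S(2) A S_sets \<mu>(2) in auto)
    moreover have "emeasure \<nu> A = emeasure \<nu> (A \<inter> S)"
      by (rule emeasure_eq_AE) (use S' A S_sets \<nu>(2) in auto)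
    ultimately show "emeasure \<mu> A = emeasure \<nu> A" using cnt[of "A \<inter> S"] by simp
  qed (simp add: \<mu> \<nu>)
qed

section \<open>The quadratic Wasserstein space over a normed space\<close>

text \<open>An arbitrary norm \<open>N\<close>, kept apart from the Euclidean \<open>norm\<close> of
  the type, which supplies the topology and the Borel sets. The metric part of the argument takes
  place at this level; the \<open>l\<^sub>q\<close> norm enters only when atoms have to be
  recovered.\<close>

locale norm_functional =
  fixes N :: "'a::euclidean_space \<Rightarrow> real"
  assumes scale: "N (c *\<^sub>R x) = \<bar>c\<bar> * N x"
    and triangle: "N (x + y) \<le> N x + N y"
    and definite: "N x = 0 \<Longrightarrow> x = 0"
begin

section \<open>Comparison with the Euclidean norm\<close>

lemma zero [simp]: "N 0 = 0" using scale[of 0 0] by simp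
lemma minus [simp]: "N (- x) = N x" using scale[of "-1" x] by simp
lemma commute: "N (x - y) = N (y - x)" using minus[of "x - y"] by simp
lemma nonneg [simp]: "0 \<le> N x" using triangle[of x "- x"] by simp
lemma eq_zero_iff [simp]: "N x = 0 \<longleftrightarrow> x = 0" using definite by auto
lemma diff_triangle: "N (x - z) \<le> N (x - y) + N (y - z)" using triangle[of "x - y" "y - z"] by simp
lemma reverse_triangle: "\<bar>N x - N y\<bar> \<le> N (x - y)"
  using triangle[of "x - y" y] triangle[of "y - x" x] commute[of x y] by simp

lemma le_norm: obtains C where "C > 0" "\<And>x. N x \<le> C * norm x"
proof
  show "1 + (\<Sum>b\<in>Basis. N b) > 0" by (intro add_pos_nonneg sum_nonneg) auto
  fix x
  have fin: "N (\<Sum>b\<in>A. f b) \<le> (\<Sum>b\<in>A. N (f b))" if "finite A" for A and f :: "'a \<Rightarrow> 'a"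
    using that by induction (auto intro: order_trans[OF triangle])
  have "N x = N (\<Sum>b\<in>Basis. (x \<bullet> b) *\<^sub>R b)" by (simp add: euclidean_representation)
  also have "\<dots> \<le> (\<Sum>b\<in>Basis. N ((x \<bullet> b) *\<^sub>R b))" by (rule fin) simp
  also have "\<dots> \<le> (\<Sum>b\<in>Basis. norm x * N b)"
    by (intro sum_mono) (auto simp: scale Basis_le_norm intro!: mult_right_mono)
  also have "\<dots> \<le> (1 + (\<Sum>b\<in>Basis. N b)) * norm x" by (simp add: sum_distrib_left[symmetric] distrib_right)
  finally show "N x \<le> (1 + (\<Sum>b\<in>Basis. N b)) * norm x" .
qed

lemma isCont_N: "isCont N x"
proof -
  obtain C where C: "C > 0" "\<And>x. N x \<le> C * norm x" using le_norm by blast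
  have "norm (N y - N x) \<le> C * norm (y - x)" for y
    using order_trans[OF reverse_triangle C(2)] by simp
  then have "\<forall>\<^sub>F y in at x. norm (N y - N x) \<le> C * norm (y - x)" by simp
  moreover have "((\<lambda>y. C * norm (y - x)) \<longlongrightarrow> C * norm (x - x)) (at x)" by (intro tendsto_intros)
  then have "((\<lambda>y. C * norm (y - x)) \<longlongrightarrow> 0) (at x)" by simp
  ultimately have "((\<lambda>y. N y - N x) \<longlongrightarrow> 0) (at x)" by (rule Lim_null_comparison)
  then show ?thesis unfolding isCont_def using LIM_zero_cancel by blast
qed

lemma continuous_on_N [continuous_intros]:
  "continuous_on S f \<Longrightarrow> continuous_on S (\<lambda>x. N (f x))"
  using continuous_on_compose2[of UNIV N S f] isCont_N by (auto simp: continuous_at_imp_continuous_on)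

lemma borel_measurable_N [measurable]: "N \<in> borel_measurable borel"
  by (intro borel_measurable_continuous_onI continuous_on_N continuous_on_id)

lemma norm_le: obtains c where "c > 0" "\<And>x. c * norm x \<le> N x"
proof -
  have "\<exists>x\<in>sphere (0::'a) 1. \<forall>y\<in>sphere 0 1. N x \<le> N y"
    by (intro continuous_attains_inf continuous_on_N continuous_on_id) auto
  then obtain x where x: "norm x = 1" "\<And>y. norm y = 1 \<Longrightarrow> N x \<le> N y" by auto
  have "N x * norm y \<le> N y" for y
  proof (cases "y = 0")
    case False
    then have "N x \<le> N (inverse (norm y) *\<^sub>R y)" by (intro x) simp
    then show ?thesis using False by (simp add: scale field_simps)
  qed simp
  moreover have "N x > 0" using x(1) by (auto simp: less_le)
  ultimately show ?thesis by (rule that[rotated])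
qed

section \<open>Borel sets and second moments\<close>

abbreviation dist_N :: "'a \<Rightarrow> 'a \<Rightarrow> real" where "dist_N x y \<equiv> N (x - y)"
abbreviation W2 :: "'a measure set" where "W2 \<equiv> wasserstein_space 2 UNIV dist_N"
abbreviation W :: "'a measure \<Rightarrow> 'a measure \<Rightarrow> real" where "W \<equiv> wasserstein_dist 2 dist_N"

lemma Metric_space_N: "Metric_space UNIV dist_N"
proof
  show "N (x - y) = N (y - x)" for x y by (rule commute)
  show "N (x - z) \<le> N (x - y) + N (y - z)" for x y z by (rule diff_triangle)
qed auto

text \<open>Norms on a finite-dimensional space are equivalent: balls of \<open>N\<close> and
  Euclidean balls lie in one another after rescaling, so both metrics have the same open sets. From
  here on every measure lives on \<open>borel\<close>.\<close>

lemma metric_borel_eq: "metric_borel UNIV dist_N = borel"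
proof -
  interpret Metric_space UNIV dist_N by (rule Metric_space_N)
  obtain C where C: "C > 0" "\<And>x. N x \<le> C * norm x" using le_norm by blast
  obtain c where c: "c > 0" "\<And>x. c * norm x \<le> N x" using norm_le by blast
  have "openin mtopology U \<longleftrightarrow> open U" for U
  proof
    assume U: "openin mtopology U"
    show "open U" unfolding open_dist
    proof
      fix x assume "x \<in> U"
      then obtain r where r: "r > 0" "mball x r \<subseteq> U" using U unfolding openin_mtopology by blast
      have "y \<in> U" if "dist y x < r / C" for y
      proof -
        have "N (x - y) \<le> C * dist y x" using C(2)[of "x - y"] by (simp add: dist_norm norm_minus_commute)
        also have "\<dots> < r" using that C(1) by (simp add: field_simps)
        finally show ?thesis using r(2) by auto
      qed
      then show "\<exists>e>0. \<forall>y. dist y x < e \<longrightarrow> y \<in> U" using r(1) C(1) by (intro exI[of _ "r / C"]) simp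
    qed
  next
    assume U: "open U"
    show "openin mtopology U" unfolding openin_mtopology
    proof (intro conjI allI impI)
      fix x assume "x \<in> U"
      then obtain e where e: "e > 0" "\<And>y. dist y x < e \<Longrightarrow> y \<in> U" using U unfolding open_dist by blast
      have "mball x (c * e) \<subseteq> U"
      proof (rule subsetI)
        fix y assume "y \<in> mball x (c * e)"
        then have "c * norm (x - y) < c * e" using c(2)[of "x - y"] by auto
        then show "y \<in> U" using c(1) by (intro e) (simp add: dist_norm norm_minus_commute)
      qed
      moreover have "c * e > 0" using e(1) c(1) by simp
      ultimately show "\<exists>r>0. mball x r \<subseteq> U" by blast
    qed (rule subset_UNIV)
  qed
  then have "{U. openin mtopology U} = {U. open U}" by blast
  then show ?thesis unfolding metric_borel_def borel_def by simp
qed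

text \<open>Moving the base point costs at most a factor 2 and a constant, by
  \<open>real_square_sum_le\<close>. This replaces the existential base point of the definition by
  an arbitrary fixed \<open>x\<close>.\<close>

lemma W2_iff:
  "\<mu> \<in> W2 \<longleftrightarrow> prob_space \<mu> \<and> sets \<mu> = sets borel \<and> integrable \<mu> (\<lambda>y. (N (x - y))\<^sup>2)"
proof -
  have "(\<integral>\<^sup>+ y. ennreal (N (y - x0) powr 2) \<partial>\<mu>) < \<infinity> \<longleftrightarrow> integrable \<mu> (\<lambda>y. (N (x - y))\<^sup>2)"
    if \<mu>: "prob_space \<mu>" "sets \<mu> = sets borel" for x0
  proof -
    interpret prob_space \<mu> by fact
    note \<mu>(2)[measurable_cong]
    have "(\<integral>\<^sup>+ y. ennreal (N (y - x0) powr 2) \<partial>\<mu>) < \<infinity> \<longleftrightarrow> integrable \<mu> (\<lambda>y. (N (x0 - y))\<^sup>2)"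
      unfolding integrable_iff_bounded by (simp add: commute[of _ x0])
    moreover have "integrable \<mu> (\<lambda>y. (N (a - y))\<^sup>2)" if "integrable \<mu> (\<lambda>y. (N (b - y))\<^sup>2)" for a b
    proof (rule Bochner_Integration.integrable_bound)
      show "integrable \<mu> (\<lambda>y. 2 * (N (a - b))\<^sup>2 + 2 * (N (b - y))\<^sup>2)" using that by simp
      have "(N (a - y))\<^sup>2 \<le> 2 * (N (a - b))\<^sup>2 + 2 * (N (b - y))\<^sup>2" for y
        by (rule order_trans[OF power_mono[OF diff_triangle] real_square_sum_le]) simp
      then show "AE y in \<mu>. norm ((N (a - y))\<^sup>2) \<le> norm (2 * (N (a - b))\<^sup>2 + 2 * (N (b - y))\<^sup>2)"
        by (simp add: order_trans[OF _ abs_ge_self])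
    qed simp
    ultimately show ?thesis by blast
  qed
  then show ?thesis unfolding wasserstein_space_def metric_borel_eq by blast
qed

lemma
  assumes "\<mu> \<in> W2"
  shows W2_prob: "prob_space \<mu>" and W2_sets: "sets \<mu> = sets borel"
    and W2_integrable: "integrable \<mu> (\<lambda>y. (N (x - y))\<^sup>2)"
    and W2_integrable': "integrable \<mu> (\<lambda>y. (N (y - x))\<^sup>2)"
    and W2_space: "space \<mu> = UNIV"
  using assms W2_iff[of \<mu> x] sets_eq_imp_space_eq[of \<mu> borel] by (auto simp: commute[of _ x])

text \<open>Linear growth bounds the square by a constant plus a multiple of the second moment. This
  covers the dilations, isometries and quantisations used below.\<close>

lemma distr_in_W2:
  assumes \<mu>: "\<mu> \<in> W2" and f[measurable]: "f \<in> borel_measurable borel"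
    and le: "\<And>y. N (f y - x) \<le> a + b * N (y - z)"
  shows "distr \<mu> borel f \<in> W2"
proof -
  interpret prob_space \<mu> using \<mu> by (rule W2_prob)
  note W2_sets[OF \<mu>, measurable_cong]
  have "integrable \<mu> (\<lambda>y. (N (x - f y))\<^sup>2)"
  proof (rule Bochner_Integration.integrable_bound)
    show "integrable \<mu> (\<lambda>y. 2 * a\<^sup>2 + 2 * (b\<^sup>2 * (N (y - z))\<^sup>2))" using W2_integrable'[OF \<mu>] by simp
    have "(N (x - f y))\<^sup>2 \<le> 2 * a\<^sup>2 + 2 * (b * N (y - z))\<^sup>2" for y
      using power_mono[OF le nonneg, of y 2] real_square_sum_le[of a "b * N (y - z)"] by (simp add: commute[of x])
    then show "AE y in \<mu>. norm ((N (x - f y))\<^sup>2) \<le> norm (2 * a\<^sup>2 + 2 * (b\<^sup>2 * (N (y - z))\<^sup>2))"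
      by (simp add: power_mult_distrib order_trans[OF _ abs_ge_self])
  qed simp
  then show ?thesis
    by (subst W2_iff[of _ x]) (simp add: prob_space_distr integrable_distr_eq)
qed

section \<open>Couplings and their cost\<close>

lemma couplings_iff:
  assumes "sets \<mu> = sets borel" "sets \<nu> = sets borel"
  shows "\<pi> \<in> couplings \<mu> \<nu> \<longleftrightarrow> prob_space \<pi> \<and> sets \<pi> = sets (borel \<Otimes>\<^sub>M borel) \<and>
    distr \<pi> borel fst = \<mu> \<and> distr \<pi> borel snd = \<nu>"
proof -
  have "distr \<pi> \<mu> fst = distr \<pi> borel fst" "distr \<pi> \<nu> snd = distr \<pi> borel snd"
    using assms by (auto intro: distr_cong)
  then show ?thesis unfolding couplings_def sets_pair_measure_cong[OF assms] by auto
qed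

definition cost :: "('a \<times> 'a) measure \<Rightarrow> real" where
  "cost \<pi> = (\<integral>z. (N (fst z - snd z))\<^sup>2 \<partial>\<pi>)"

lemma cost_nonneg: "0 \<le> cost \<pi>"
  unfolding cost_def by (rule integral_nonneg_AE) simp

lemma W_eq: "W \<mu> \<nu> = (INF \<pi>\<in>couplings \<mu> \<nu>. sqrt (cost \<pi>))"
  unfolding wasserstein_dist_def cost_def
  by (simp add: case_prod_beta' powr_half_sqrt cong: INF_cong)

lemma W_le: "\<pi> \<in> couplings \<mu> \<nu> \<Longrightarrow> W \<mu> \<nu> \<le> sqrt (cost \<pi>)"
  unfolding W_eq by (rule cINF_lower) (auto intro: bdd_belowI2[where m=0] simp: cost_nonneg)

text \<open>Provides nonemptiness of the set of couplings, so that a common lower bound of all costs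
  passes to the infimum. The product is also the competitor by which Dirac measures are
  recognised.\<close>

lemma product_coupling:
  assumes "\<mu> \<in> W2" "\<nu> \<in> W2"
  shows "\<mu> \<Otimes>\<^sub>M \<nu> \<in> couplings \<mu> \<nu>"
proof -
  interpret A: prob_space \<mu> using assms(1) by (rule W2_prob)
  interpret B: prob_space \<nu> using assms(2) by (rule W2_prob)
  interpret P: pair_prob_space \<mu> \<nu> ..
  have "\<mu> = distr (\<mu> \<Otimes>\<^sub>M \<nu>) \<mu> fst" by (rule B.distr_pair_fst[symmetric])
  moreover have "distr (\<mu> \<Otimes>\<^sub>M \<nu>) \<nu> snd = \<nu>"
  proof -
    have "distr (\<mu> \<Otimes>\<^sub>M \<nu>) \<nu> snd = distr (\<nu> \<Otimes>\<^sub>M \<mu>) \<nu> fst"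
      by (subst P.distr_pair_swap) (simp add: distr_distr comp_def case_prod_beta')
    then show ?thesis by (simp add: A.distr_pair_fst)
  qed
  ultimately show ?thesis unfolding couplings_def
    by (simp add: P.prob_space_axioms)
qed

lemma le_W:
  assumes "\<mu> \<in> W2" "\<nu> \<in> W2" "\<And>\<pi>. \<pi> \<in> couplings \<mu> \<nu> \<Longrightarrow> a \<le> sqrt (cost \<pi>)"
  shows "a \<le> W \<mu> \<nu>"
  unfolding W_eq using product_coupling[OF assms(1,2)] assms(3) by (intro cINF_greatest) auto

text \<open>The plan carried by the graph of \<open>f\<close>; it gives the upper bounds for
  \<open>W\<close> between a measure and its image.\<close>

lemma map_coupling:
  assumes "\<mu> \<in> W2" and [measurable]: "f \<in> borel_measurable borel"
  shows "distr \<mu> (borel \<Otimes>\<^sub>M borel) (\<lambda>x. (x, f x)) \<in> couplings \<mu> (distr \<mu> borel f)"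
    and "cost (distr \<mu> (borel \<Otimes>\<^sub>M borel) (\<lambda>x. (x, f x))) = (\<integral>x. (N (x - f x))\<^sup>2 \<partial>\<mu>)"
proof -
  interpret prob_space \<mu> using assms(1) by (rule W2_prob)
  note W2_sets[OF assms(1), measurable_cong]
  show "cost (distr \<mu> (borel \<Otimes>\<^sub>M borel) (\<lambda>x. (x, f x))) = (\<integral>x. (N (x - f x))\<^sup>2 \<partial>\<mu>)"
    unfolding cost_def by (subst integral_distr) auto
  have "distr \<mu> borel (\<lambda>x. x) = \<mu>" by (rule distr_id2) (simp add: W2_sets[OF assms(1)])
  then show "distr \<mu> (borel \<Otimes>\<^sub>M borel) (\<lambda>x. (x, f x)) \<in> couplings \<mu> (distr \<mu> borel f)"
    by (subst couplings_iff) (auto simp: W2_sets[OF assms(1)] distr_distr comp_def intro!: prob_space_distr)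
qed

lemma W_map_le:
  assumes "\<mu> \<in> W2" "f \<in> borel_measurable borel"
  shows "W \<mu> (distr \<mu> borel f) \<le> sqrt (\<integral>x. (N (x - f x))\<^sup>2 \<partial>\<mu>)"
  using W_le[OF map_coupling(1)[OF assms]] map_coupling(2)[OF assms] by simp

lemma coupling_integral:
  fixes g :: "'a \<Rightarrow> real"
  assumes "\<mu> \<in> W2" "\<nu> \<in> W2" "\<pi> \<in> couplings \<mu> \<nu>" and [measurable]: "g \<in> borel_measurable borel"
  shows "(\<integral>z. g (fst z) \<partial>\<pi>) = integral\<^sup>L \<mu> g" "(\<integral>z. g (snd z) \<partial>\<pi>) = integral\<^sup>L \<nu> g"
    and "integrable \<mu> g \<Longrightarrow> integrable \<pi> (\<lambda>z. g (fst z))"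
    and "integrable \<nu> g \<Longrightarrow> integrable \<pi> (\<lambda>z. g (snd z))"
proof -
  from assms(3) have *: "sets \<pi> = sets (borel \<Otimes>\<^sub>M borel)" "distr \<pi> borel fst = \<mu>" "distr \<pi> borel snd = \<nu>"
    using couplings_iff[OF W2_sets[OF assms(1)] W2_sets[OF assms(2)]] by auto
  note *(1)[measurable_cong]
  show "(\<integral>z. g (fst z) \<partial>\<pi>) = integral\<^sup>L \<mu> g" by (subst *(2)[symmetric], subst integral_distr) auto
  show "(\<integral>z. g (snd z) \<partial>\<pi>) = integral\<^sup>L \<nu> g" by (subst *(3)[symmetric], subst integral_distr) auto
  show "integrable \<mu> g \<Longrightarrow> integrable \<pi> (\<lambda>z. g (fst z))"
    by (subst (asm) *(2)[symmetric], subst (asm) integrable_distr_eq) auto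
  show "integrable \<nu> g \<Longrightarrow> integrable \<pi> (\<lambda>z. g (snd z))"
    by (subst (asm) *(3)[symmetric], subst (asm) integrable_distr_eq) auto
qed

lemma coupling_cost_integrable:
  assumes "\<mu> \<in> W2" "\<nu> \<in> W2" "\<pi> \<in> couplings \<mu> \<nu>"
  shows "integrable \<pi> (\<lambda>z. (N (fst z - snd z))\<^sup>2)"
proof (rule Bochner_Integration.integrable_bound)
  from assms(3) have *[measurable_cong]: "sets \<pi> = sets (borel \<Otimes>\<^sub>M borel)"
    using couplings_iff[OF W2_sets[OF assms(1)] W2_sets[OF assms(2)]] by auto
  show "integrable \<pi> (\<lambda>z. 2 * (N (fst z - 0))\<^sup>2 + 2 * (N (0 - snd z))\<^sup>2)"
    using coupling_integral(3)[OF assms _ W2_integrable'[OF assms(1), of 0]]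
      coupling_integral(4)[OF assms _ W2_integrable[OF assms(2), of 0]] by simp
  have "(N (x - y))\<^sup>2 \<le> 2 * (N (x - 0))\<^sup>2 + 2 * (N (0 - y))\<^sup>2" for x y
    by (rule order_trans[OF power_mono[OF diff_triangle[of x y 0]] real_square_sum_le]) simp
  then show "AE z in \<pi>. norm ((N (fst z - snd z))\<^sup>2)
      \<le> norm (2 * (N (fst z - 0))\<^sup>2 + 2 * (N (0 - snd z))\<^sup>2)"
    by (simp add: order_trans[OF _ abs_ge_self])
  show "(\<lambda>z. (N (fst z - snd z))\<^sup>2) \<in> borel_measurable \<pi>" by measurable
qed

lemma W_eq_sqrt:
  assumes "\<mu> \<in> W2" "\<nu> \<in> W2" "\<And>\<pi>. \<pi> \<in> couplings \<mu> \<nu> \<Longrightarrow> cost \<pi> = c"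
  shows "W \<mu> \<nu> = sqrt c"
proof (rule antisym)
  show "W \<mu> \<nu> \<le> sqrt c"
    using W_le[OF product_coupling[OF assms(1,2)]] assms(3)[OF product_coupling[OF assms(1,2)]] by simp
  show "sqrt c \<le> W \<mu> \<nu>" using assms by (intro le_W) auto
qed

section \<open>Distances to Dirac measures\<close>

lemma return_in_W2: "return borel x \<in> W2"
  by (subst W2_iff[of _ x])
     (auto simp: prob_space_return integrable_iff_bounded nn_integral_return)

lemma AE_coupling_return:
  assumes "\<mu> \<in> W2" "\<nu> \<in> W2" "\<pi> \<in> couplings \<mu> \<nu>"
  shows "\<mu> = return borel x \<Longrightarrow> AE z in \<pi>. fst z = x"
    and "\<nu> = return borel x \<Longrightarrow> AE z in \<pi>. snd z = x"
proof -
  from assms(3) have *: "sets \<pi> = sets (borel \<Otimes>\<^sub>M borel)" "distr \<pi> borel fst = \<mu>" "distr \<pi> borel snd = \<nu>"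
    using couplings_iff[OF W2_sets[OF assms(1)] W2_sets[OF assms(2)]] by auto
  note *(1)[measurable_cong]
  have [measurable]: "fst \<in> measurable \<pi> borel" "snd \<in> measurable \<pi> borel" by measurable
  have r: "AE y in return borel x. y = x" by (subst AE_return) auto
  show "AE z in \<pi>. fst z = x" if "\<mu> = return borel x"
  proof (rule AE_distrD[where M'=borel and f=fst and P="\<lambda>y. y = x"])
    show "AE y in distr \<pi> borel fst. y = x" unfolding *(2) that by (rule r)
  qed simp
  show "AE z in \<pi>. snd z = x" if "\<nu> = return borel x"
  proof (rule AE_distrD[where M'=borel and f=snd and P="\<lambda>y. y = x"])
    show "AE y in distr \<pi> borel snd. y = x" unfolding *(3) that by (rule r)
  qed simp
qed

text \<open>Under a coupling with a Dirac marginal one coordinate is almost surely constant, so all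
  couplings have the same cost and the infimum is a plain integral. The integrand is
  \<open>N (x - y)\<close> here and in \<open>W_return_right\<close>, so that both distances are
  visibly the root of one potential.\<close>

lemma W_return_left:
  assumes "\<mu> \<in> W2"
  shows "W (return borel x) \<mu> = sqrt (\<integral>y. (N (x - y))\<^sup>2 \<partial>\<mu>)"
proof -
  have "cost \<pi> = (\<integral>y. (N (x - y))\<^sup>2 \<partial>\<mu>)" if \<pi>: "\<pi> \<in> couplings (return borel x) \<mu>" for \<pi>
  proof -
    note c = return_in_W2[of x] assms \<pi>
    from \<pi> have *[measurable_cong]: "sets \<pi> = sets (borel \<Otimes>\<^sub>M borel)"
      using couplings_iff[OF W2_sets[OF c(1)] W2_sets[OF c(2)]] by auto
    have "cost \<pi> = (\<integral>z. (N (x - snd z))\<^sup>2 \<partial>\<pi>)" unfolding cost_def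
      using AE_coupling_return(1)[OF c refl] by (intro integral_cong_AE) auto
    then show ?thesis using coupling_integral(2)[OF c, of "\<lambda>y. (N (x - y))\<^sup>2"] by simp
  qed
  with return_in_W2 assms show ?thesis by (rule W_eq_sqrt)
qed

lemma W_return_right:
  assumes "\<mu> \<in> W2"
  shows "W \<mu> (return borel x) = sqrt (\<integral>y. (N (x - y))\<^sup>2 \<partial>\<mu>)"
proof -
  have "cost \<pi> = (\<integral>y. (N (x - y))\<^sup>2 \<partial>\<mu>)" if \<pi>: "\<pi> \<in> couplings \<mu> (return borel x)" for \<pi>
  proof -
    note c = assms return_in_W2[of x] \<pi>
    from \<pi> have *[measurable_cong]: "sets \<pi> = sets (borel \<Otimes>\<^sub>M borel)"
      using couplings_iff[OF W2_sets[OF c(1)] W2_sets[OF c(2)]] by auto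
    have "cost \<pi> = (\<integral>z. (N (x - fst z))\<^sup>2 \<partial>\<pi>)" unfolding cost_def
      using AE_coupling_return(2)[OF c refl] by (intro integral_cong_AE) (auto simp: commute[of x])
    then show ?thesis using coupling_integral(1)[OF c, of "\<lambda>y. (N (x - y))\<^sup>2"] by simp
  qed
  with assms return_in_W2 show ?thesis by (rule W_eq_sqrt)
qed

lemma W_return_return: "W (return borel x) (return borel y) = N (x - y)"
  by (simp add: W_return_left[OF return_in_W2] integral_return)

text \<open>The elementary half of Kantorovich duality: a Lipschitz function separates the marginals
  of a coupling by at most \<open>L\<close> times the mean displacement, which
  \<open>square_expectation_le\<close> bounds by the root of the cost.\<close>

lemma W_Lipschitz:
  assumes \<mu>\<nu>: "\<mu> \<in> W2" "\<nu> \<in> W2" and L: "L > 0" "\<And>x y. \<bar>h x - h y\<bar> \<le> L * N (x - y)"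
    and [measurable]: "h \<in> borel_measurable borel" and int: "integrable \<mu> h" "integrable \<nu> h"
  shows "\<bar>integral\<^sup>L \<mu> h - integral\<^sup>L \<nu> h\<bar> \<le> L * W \<mu> \<nu>"
proof -
  have "\<bar>integral\<^sup>L \<mu> h - integral\<^sup>L \<nu> h\<bar> / L \<le> sqrt (cost \<pi>)" if \<pi>: "\<pi> \<in> couplings \<mu> \<nu>" for \<pi>
  proof -
    note c = \<mu>\<nu> \<pi>
    from \<pi> have *[measurable_cong]: "sets \<pi> = sets (borel \<Otimes>\<^sub>M borel)" and "prob_space \<pi>"
      using couplings_iff[OF W2_sets[OF c(1)] W2_sets[OF c(2)]] by auto
    interpret prob_space \<pi> by fact
    have [measurable]: "(\<lambda>z. N (fst z - snd z)) \<in> borel_measurable \<pi>" by measurable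
    have hi: "integrable \<pi> (\<lambda>z. h (fst z))" "integrable \<pi> (\<lambda>z. h (snd z))"
      using coupling_integral(3,4)[OF c] int by auto
    note sq = square_expectation_le[OF _ coupling_cost_integrable[OF c]]
    have "\<bar>integral\<^sup>L \<mu> h - integral\<^sup>L \<nu> h\<bar> = \<bar>\<integral>z. h (fst z) - h (snd z) \<partial>\<pi>\<bar>"
      using hi coupling_integral(1,2)[OF c, of h] by simp
    also have "\<dots> \<le> (\<integral>z. \<bar>h (fst z) - h (snd z)\<bar> \<partial>\<pi>)" by (rule integral_abs_bound)
    also have "\<dots> \<le> (\<integral>z. L * N (fst z - snd z) \<partial>\<pi>)"
      using hi sq(1) L by (intro integral_mono) auto
    also have "\<dots> = L * (\<integral>z. N (fst z - snd z) \<partial>\<pi>)" by simp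
    also have "\<dots> \<le> L * sqrt (cost \<pi>)"
      using sq(2) L unfolding cost_def by (intro mult_left_mono real_le_rsqrt) auto
    finally show ?thesis using L by (simp add: field_simps)
  qed
  then have "\<bar>integral\<^sup>L \<mu> h - integral\<^sup>L \<nu> h\<bar> / L \<le> W \<mu> \<nu>" by (rule le_W[OF \<mu>\<nu>])
  then show ?thesis using L by (simp add: field_simps)
qed

subsection \<open>Dirac measures\<close>

text \<open>The dilation by 2 about \<open>x\<close> doubles distances to \<open>x\<close> and moves
  each \<open>y\<close> by \<open>y - x\<close>. The image of \<open>\<nu>\<close> therefore
  prolongs the segment from the Dirac measure at \<open>x\<close> to \<open>\<nu>\<close>.\<close>

lemma return_extends:
  assumes \<nu>: "\<nu> \<in> W2"
  shows "\<exists>\<rho>\<in>W2. W (return borel x) \<rho> = 2 * W \<nu> (return borel x) \<and> W \<nu> \<rho> \<le> W \<nu> (return borel x)"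
proof -
  interpret prob_space \<nu> using \<nu> by (rule W2_prob)
  note W2_sets[OF \<nu>, measurable_cong]
  define f where "f y = x + 2 *\<^sub>R (y - x)" for y
  have [measurable]: "f \<in> borel_measurable borel" unfolding f_def by measurable
  have N1: "N (x - f y) = 2 * N (x - y)" for y
    using scale[of 2 "y - x"] commute[of x "f y"] commute[of x y] by (simp add: f_def)
  have N2: "N (y - f y) = N (x - y)" for y
    by (rule arg_cong[where f=N]) (simp add: f_def algebra_simps scaleR_2)
  have \<rho>: "distr \<nu> borel f \<in> W2"
    using N1 by (intro distr_in_W2[OF \<nu>, of f x 0 2 x]) (simp_all add: commute[of _ x])
  have "W (return borel x) (distr \<nu> borel f) = sqrt (\<integral>y. (N (x - f y))\<^sup>2 \<partial>\<nu>)"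
    unfolding W_return_left[OF \<rho>] by (subst integral_distr) auto
  also have "\<dots> = sqrt (2\<^sup>2 * (\<integral>y. (N (x - y))\<^sup>2 \<partial>\<nu>))" unfolding N1 by (simp add: power_mult_distrib)
  also have "\<dots> = 2 * W \<nu> (return borel x)" unfolding W_return_right[OF \<nu>] real_sqrt_mult by simp
  finally have 1: "W (return borel x) (distr \<nu> borel f) = 2 * W \<nu> (return borel x)" .
  have "W \<nu> (distr \<nu> borel f) \<le> sqrt (\<integral>y. (N (y - f y))\<^sup>2 \<partial>\<nu>)" by (rule W_map_le[OF \<nu>]) simp
  then have "W \<nu> (distr \<nu> borel f) \<le> W \<nu> (return borel x)"
    unfolding N2 W_return_right[OF \<nu>] .
  with 1 \<rho> show ?thesis by blast
qed

text \<open>Equality in the triangle inequality through \<open>return borel y\<close> forces \<open>N (x - y) = N (y - z)\<close>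
  for almost all pairs under the product coupling, so \<open>N (x - y)\<close> is almost surely constant for
  each \<open>y\<close>; a point is determined by its distances to a dense set.\<close>

lemma eq_return_if_extends:
  assumes \<mu>: "\<mu> \<in> W2"
    and ext: "\<And>y. \<exists>\<rho>\<in>W2. W \<mu> \<rho> = 2 * W (return borel y) \<mu> \<and> W (return borel y) \<rho> \<le> W (return borel y) \<mu>"
  obtains x where "\<mu> = return borel x"
proof -
  interpret A: prob_space \<mu> using \<mu> by (rule W2_prob)
  note W2_sets[OF \<mu>, measurable_cong]
  have "\<exists>c. AE x in \<mu>. N (x - y) = c" for y
  proof -
    obtain \<rho> where \<rho>: "\<rho> \<in> W2" "W \<mu> \<rho> = 2 * W (return borel y) \<mu>"
      "W (return borel y) \<rho> \<le> W (return borel y) \<mu>" using ext by blast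
    interpret B: prob_space \<rho> using \<rho>(1) by (rule W2_prob)
    interpret P: pair_prob_space \<mu> \<rho> ..
    note W2_sets[OF \<rho>(1), measurable_cong]
    define P where "P = \<mu> \<Otimes>\<^sub>M \<rho>"
    have [measurable_cong]: "sets P = sets (borel \<Otimes>\<^sub>M borel)"
      unfolding P_def by (rule sets_pair_measure_cong) (simp_all add: W2_sets[OF \<mu>] W2_sets[OF \<rho>(1)])
    note c = \<mu> \<rho>(1) product_coupling[OF \<mu> \<rho>(1), folded P_def]
    let ?s = "\<lambda>z. N (fst z - y)" and ?t = "\<lambda>z. N (y - snd z)"
    define a b where "a = (\<integral>x. (N (x - y))\<^sup>2 \<partial>\<mu>)" and "b = (\<integral>x. (N (y - x))\<^sup>2 \<partial>\<rho>)"
    have W1: "W (return borel y) \<mu> = sqrt a" by (simp add: W_return_left[OF \<mu>] a_def commute[of y])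
    have W2: "W (return borel y) \<rho> = sqrt b" by (simp add: W_return_left[OF \<rho>(1)] b_def)
    have "b \<le> a" using \<rho>(3) by (simp add: W1 W2)
    have i: "integrable P (\<lambda>z. (?s z)\<^sup>2)" "integrable P (\<lambda>z. (?t z)\<^sup>2)"
      using coupling_integral(3)[OF c _ W2_integrable'[OF \<mu>, of y]]
        coupling_integral(4)[OF c _ W2_integrable[OF \<rho>(1), of y]] by simp_all
    have e: "(\<integral>z. (?s z)\<^sup>2 \<partial>P) = a" "(\<integral>z. (?t z)\<^sup>2 \<partial>P) = b"
      unfolding a_def b_def using coupling_integral(1)[OF c, of "\<lambda>x. (N (x - y))\<^sup>2"]
        coupling_integral(2)[OF c, of "\<lambda>x. (N (y - x))\<^sup>2"] by simp_all
    have st: "(?s z - ?t z)\<^sup>2 = 2 * (?s z)\<^sup>2 + 2 * (?t z)\<^sup>2 - (?s z + ?t z)\<^sup>2" for z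
      by (simp add: power2_eq_square algebra_simps)
    have ist: "integrable P (\<lambda>z. (?s z + ?t z)\<^sup>2)"
      by (rule Bochner_Integration.integrable_bound[of _ "\<lambda>z. 2 * (?s z)\<^sup>2 + 2 * (?t z)\<^sup>2"])
         (use i in \<open>auto simp: real_square_sum_le\<close>)
    \<comment> \<open>The product coupling competes in \<open>W \<mu> \<rho>\<close>, whence
      \<open>4 * a \<le> cost P\<close>, while the triangle inequality through \<open>y\<close>
      bounds \<open>cost P\<close> by the integral of the squared sum. By the parallelogram identity
      \<open>st\<close> the integral of the squared difference is at most
      \<open>2 * a + 2 * b - 4 * a\<close>, which is at most 0 as \<open>b \<le> a\<close>.\<close>
    have "2 * sqrt a \<le> sqrt (cost P)" using W_le[OF c(3)] \<rho>(2) by (simp add: W1)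
    then have "(2 * sqrt a)\<^sup>2 \<le> (sqrt (cost P))\<^sup>2"
      by (rule power_mono) (simp add: a_def)
    then have "4 * a \<le> cost P" by (simp add: cost_nonneg power_mult_distrib a_def)
    also have "cost P \<le> (\<integral>z. (?s z + ?t z)\<^sup>2 \<partial>P)" unfolding cost_def
      using coupling_cost_integrable[OF c] ist by (intro integral_mono power_mono diff_triangle) auto
    finally have "(\<integral>z. (?s z - ?t z)\<^sup>2 \<partial>P) \<le> 0"
      unfolding st using i ist e \<open>b \<le> a\<close> by simp
    moreover have ii: "integrable P (\<lambda>z. (?s z - ?t z)\<^sup>2)" unfolding st using i ist by simp
    ultimately have "(\<integral>z. (?s z - ?t z)\<^sup>2 \<partial>P) = 0" by (intro antisym integral_nonneg_AE) auto
    then have "AE z in P. (?s z - ?t z)\<^sup>2 = 0"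
      using ii by (subst (asm) integral_nonneg_eq_0_iff_AE) auto
    then have "AE z in \<mu> \<Otimes>\<^sub>M \<rho>. ?s z = ?t z" unfolding P_def by simp
    then have ae: "AE x in \<mu>. AE z in \<rho>. N (x - y) = N (y - z)"
      using P.AE_pair by fastforce
    \<comment> \<open>A single \<open>x0\<close> shows \<open>N (y - z)\<close> to be constant for
      almost all \<open>z\<close>; any other \<open>x\<close> is compared with it through a common
      \<open>z\<close>, which exists because \<open>\<rho>\<close> is a probability measure.\<close>
    then obtain x0 where x0: "AE z in \<rho>. N (x0 - y) = N (y - z)"
      using eventually_happens'[OF A.ae_filter_bot] by blast
    from ae have "AE x in \<mu>. N (x - y) = N (x0 - y)"
    proof eventually_elim
      fix x assume "AE z in \<rho>. N (x - y) = N (y - z)"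
      with x0 have "AE z in \<rho>. N (x - y) = N (x0 - y)" by eventually_elim simp
      then show "N (x - y) = N (x0 - y)" using B.AE_const by simp
    qed
    then show ?thesis by blast
  qed
  then obtain c where c: "\<And>y. AE x in \<mu>. N (x - y) = c y" by metis
  obtain D :: "'a set" where D: "countable D" "\<And>X. open X \<Longrightarrow> X \<noteq> {} \<Longrightarrow> \<exists>d\<in>D. d \<in> X"
    using countable_dense_setE by blast
  have ae: "AE x in \<mu>. \<forall>y\<in>D. N (x - y) = c y" using c D(1) by (simp add: AE_ball_countable)
  then obtain x0 where x0: "\<forall>y\<in>D. N (x0 - y) = c y"
    using eventually_happens'[OF A.ae_filter_bot] by blast
  from ae have "AE x in \<mu>. x = x0"
  proof eventually_elim
    fix x assume x: "\<forall>y\<in>D. N (x - y) = c y"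
    have "open {y. N (x0 - y) \<noteq> N (x - y)}"
      by (intro open_Collect_neq continuous_intros)
    with D(2) x x0 have "{y. N (x0 - y) \<noteq> N (x - y)} = {}" by fastforce
    then have "N (x0 - x0) = N (x - x0)" by blast
    then show "x = x0" by simp
  qed
  with A.prob_space_axioms W2_sets[OF \<mu>] show ?thesis
    by (intro that prob_measure_eq_return)
qed

text \<open>Prolongability is a metric property, so \<open>\<Phi>\<close> transports it.
  \<open>return_extends\<close> admits an arbitrary midpoint \<open>\<nu>\<close>, whereas
  \<open>eq_return_if_extends\<close> asks only for Dirac midpoints. Hence the preimage of a Dirac
  midpoint may be any measure in the first step, when preimages of Dirac measures are not yet known
  to be Dirac.\<close>

lemma isometry_maps_returns:
  assumes \<Phi>: "isometry_of W2 W \<Phi>"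
  obtains \<phi> where "isometry_of UNIV dist_N \<phi>" "\<And>x. \<Phi> (return borel x) = return borel (\<phi> x)"
proof -
  have bij: "bij_betw \<Phi> W2 W2" and iso: "\<And>\<mu> \<nu>. \<mu> \<in> W2 \<Longrightarrow> \<nu> \<in> W2 \<Longrightarrow> W (\<Phi> \<mu>) (\<Phi> \<nu>) = W \<mu> \<nu>"
    using \<Phi> unfolding isometry_of_def by auto
  have in_W2: "\<Phi> \<mu> \<in> W2" if "\<mu> \<in> W2" for \<mu> using bij that by (rule bij_betw_apply)
  have surj: "\<exists>\<mu>\<in>W2. \<Phi> \<mu> = \<nu>" if "\<nu> \<in> W2" for \<nu>
  proof -
    have "\<nu> \<in> \<Phi> ` W2" using that bij_betw_imp_surj_on[OF bij] by simp
    then show ?thesis by blast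
  qed
  have "\<exists>y. \<Phi> (return borel x) = return borel y" for x
  proof -
    have "\<exists>\<rho>\<in>W2. W (\<Phi> (return borel x)) \<rho> = 2 * W (return borel y) (\<Phi> (return borel x)) \<and>
        W (return borel y) \<rho> \<le> W (return borel y) (\<Phi> (return borel x))" for y
    proof -
      obtain \<nu> where \<nu>: "\<nu> \<in> W2" "\<Phi> \<nu> = return borel y" using surj return_in_W2 by blast
      obtain \<rho> where "\<rho> \<in> W2" "W (return borel x) \<rho> = 2 * W \<nu> (return borel x)" "W \<nu> \<rho> \<le> W \<nu> (return borel x)"
        using return_extends[OF \<nu>(1)] by blast
      then show ?thesis
        using iso[of "return borel x" \<rho>] iso[of \<nu> \<rho>] iso[of \<nu> "return borel x"] \<nu> return_in_W2[of x]
        by (intro bexI[of _ "\<Phi> \<rho>"]) (auto intro: in_W2)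
    qed
    then show ?thesis using eq_return_if_extends[OF in_W2[OF return_in_W2]] by metis
  qed
  then obtain \<phi> where \<phi>: "\<And>x. \<Phi> (return borel x) = return borel (\<phi> x)" by metis
  have d: "N (\<phi> x - \<phi> y) = N (x - y)" for x y
    using iso[OF return_in_W2 return_in_W2, of x y] by (simp add: \<phi> W_return_return)
  \<comment> \<open>Surjectivity of \<open>\<phi>\<close>: the preimage \<open>\<nu>\<close> of a
    Dirac measure is tested with the midpoints \<open>return borel x\<close>. Their images are
    Dirac, so the segment can be prolonged on the image side and pulled back, and
    \<open>\<nu>\<close> is Dirac.\<close>
  have "\<exists>x. \<phi> x = y" for y
  proof -
    obtain \<nu> where \<nu>: "\<nu> \<in> W2" "\<Phi> \<nu> = return borel y" using surj return_in_W2 by blast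
    have "\<exists>\<rho>\<in>W2. W \<nu> \<rho> = 2 * W (return borel x) \<nu> \<and> W (return borel x) \<rho> \<le> W (return borel x) \<nu>" for x
    proof -
      obtain \<rho>' where *: "\<rho>' \<in> W2" "W (return borel y) \<rho>' = 2 * W (return borel (\<phi> x)) (return borel y)"
        "W (return borel (\<phi> x)) \<rho>' \<le> W (return borel (\<phi> x)) (return borel y)"
        using return_extends[OF return_in_W2] by blast
      obtain \<rho> where \<rho>: "\<rho> \<in> W2" "\<Phi> \<rho> = \<rho>'" using surj *(1) by blast
      show ?thesis
        using * iso[OF \<nu>(1) \<rho>(1)] iso[OF return_in_W2 \<rho>(1), of x] iso[OF return_in_W2 \<nu>(1), of x]
        by (intro bexI[OF _ \<rho>(1)]) (simp add: \<nu> \<rho> \<phi>)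
    qed
    then obtain x where "\<nu> = return borel x" using eq_return_if_extends[OF \<nu>(1)] by metis
    then have "W (return borel (\<phi> x)) (return borel y) = W (return borel y) (return borel y)"
      using \<phi>[of x] \<nu>(2) by simp
    then show ?thesis by (auto simp: W_return_return)
  qed
  moreover have "inj \<phi>"
  proof (rule injI)
    fix x y assume "\<phi> x = \<phi> y"
    then show "x = y" using d[of x y] by simp
  qed
  ultimately have "isometry_of UNIV dist_N \<phi>"
    unfolding isometry_of_def by (auto simp: bij_def surj_def d) (metis)
  with \<phi> show ?thesis by (rule that[rotated])
qed

subsection \<open>From atoms to rigidity\<close>

text \<open>An isometry for \<open>N\<close> is Lipschitz for the Euclidean metric with constant
  \<open>C / c\<close>, hence continuous.\<close>

lemma isometry_borel_measurable:
  assumes "isometry_of UNIV dist_N f"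
  shows "f \<in> borel_measurable borel"
proof -
  obtain C where C: "C > 0" "\<And>x. N x \<le> C * norm x" using le_norm by blast
  obtain c where c: "c > 0" "\<And>x. c * norm x \<le> N x" using norm_le by blast
  have "dist (f x) (f y) \<le> C / c * dist x y" for x y
  proof -
    have "c * norm (f x - f y) \<le> C * norm (x - y)"
      using c(2)[of "f x - f y"] C(2)[of "x - y"] assms unfolding isometry_of_def by auto
    then show ?thesis using c(1) by (simp add: dist_norm field_simps)
  qed
  then have "(C / c)-lipschitz_on UNIV f"
    using C(1) c(1) by (intro lipschitz_onI) simp_all
  then show ?thesis by (intro borel_measurable_continuous_onI lipschitz_on_continuous_on)
qed

lemma isometry_inv:
  assumes "isometry_of UNIV dist_N f"
  shows "isometry_of UNIV dist_N (inv f)" and "f (inv f x) = x" "inv f (f x) = x"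
proof -
  have "bij f" and d: "\<And>x y. N (f x - f y) = N (x - y)" using assms unfolding isometry_of_def by auto
  then have inv: "f (inv f x) = x" "inv f (f x) = x" for x
    by (auto simp: bij_is_surj surj_f_inv_f bij_is_inj)
  show "f (inv f x) = x" "inv f (f x) = x" by (fact inv)+
  show "isometry_of UNIV dist_N (inv f)"
    unfolding isometry_of_def using \<open>bij f\<close> d[of "inv f x" "inv f y" for x y] inv
    by (auto simp: bij_imp_bij_inv)
qed

text \<open>Each point moves to the first point of a dense sequence at distance below
  \<open>\<epsilon>\<close>; taking the least index keeps the map measurable. The displacement is
  uniformly small, so the cost is at most \<open>\<epsilon>\<^sup>2\<close> and the second moment
  stays finite, with a countable rather than finite support.\<close>

lemma W2_discrete_approximation:
  assumes \<mu>: "\<mu> \<in> W2" and "\<epsilon> > 0"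
  obtains \<sigma> S where "\<sigma> \<in> W2" "countable S" "AE x in \<sigma>. x \<in> S" "W \<mu> \<sigma> \<le> \<epsilon>"
proof -
  interpret prob_space \<mu> using \<mu> by (rule W2_prob)
  note W2_sets[OF \<mu>, measurable_cong]
  obtain D :: "'a set" where D: "countable D" "\<And>X. open X \<Longrightarrow> X \<noteq> {} \<Longrightarrow> \<exists>d\<in>D. d \<in> X"
    using countable_dense_setE by blast
  define g where "g = from_nat_into D"
  define i where "i x = (LEAST n. N (x - g n) < \<epsilon>)" for x
  define f where "f x = g (i x)" for x
  have "\<exists>n. N (x - g n) < \<epsilon>" for x
  proof -
    have "open {y. N (x - y) < \<epsilon>}" by (intro open_Collect_less continuous_intros)
    moreover have "x \<in> {y. N (x - y) < \<epsilon>}" using \<open>\<epsilon> > 0\<close> by simp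
    ultimately obtain d where "d \<in> D" "N (x - d) < \<epsilon>" using D(2) by blast
    then show ?thesis using from_nat_into_surj[OF D(1)] unfolding g_def by metis
  qed
  then have f: "N (x - f x) < \<epsilon>" for x unfolding f_def i_def by (rule LeastI_ex)
  have [measurable]: "i \<in> measurable borel (count_space UNIV)" unfolding i_def by measurable
  have [measurable]: "f \<in> borel_measurable borel"
    unfolding f_def by (rule measurable_compose[OF \<open>i \<in> _\<close>]) simp
  have "N (f y - 0) \<le> \<epsilon> + 1 * N (y - 0)" for y
    using diff_triangle[of "f y" 0 y] commute[of y "f y"] f[of y] by simp
  from distr_in_W2[OF \<mu> _ this] have \<sigma>: "distr \<mu> borel f \<in> W2" by simp
  have "(N (x - f x))\<^sup>2 \<le> \<epsilon>\<^sup>2" for x using f[of x] by (intro power_mono) simp_all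
  then have "(\<integral>x. (N (x - f x))\<^sup>2 \<partial>\<mu>) \<le> (\<integral>x. \<epsilon>\<^sup>2 \<partial>\<mu>)"
    by (intro integral_mono integrable_const_bound[where B="\<epsilon>\<^sup>2"]) auto
  then have "sqrt (\<integral>x. (N (x - f x))\<^sup>2 \<partial>\<mu>) \<le> \<epsilon>"
    using \<open>\<epsilon> > 0\<close> by (intro real_le_lsqrt) (simp_all add: prob_space)
  then have W: "W \<mu> (distr \<mu> borel f) \<le> \<epsilon>" using W_map_le[OF \<mu>, of f] by simp
  have cnt: "countable (range f)"
    by (rule countable_subset[of _ "range g"]) (auto simp: f_def)
  have "AE x in distr \<mu> borel f. x \<in> range f"
    using sets.countable[OF _ cnt, of borel] by (subst AE_distr_iff) auto
  with \<sigma> cnt show ?thesis using W by (rule that)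
qed

text \<open>The cut-offs \<open>max 0 (1 - (k + 1) * infdist x C)\<close> are bounded, Lipschitz and
  converge to the indicator of a closed \<open>C\<close>; closed sets are an intersection-stable
  generator of the Borel sets.\<close>

lemma prob_measures_eqI_Lipschitz:
  assumes \<mu>: "prob_space \<mu>" "sets \<mu> = sets (borel :: 'a measure)"
    and \<nu>: "prob_space \<nu>" "sets \<nu> = sets (borel :: 'a measure)"
    and eq: "\<And>h L. h \<in> borel_measurable borel \<Longrightarrow> L > 0 \<Longrightarrow> (\<And>x y. \<bar>h x - h y\<bar> \<le> L * N (x - y)) \<Longrightarrow>
      (\<And>x. 0 \<le> h x \<and> h x \<le> 1) \<Longrightarrow> integral\<^sup>L \<mu> h = (integral\<^sup>L \<nu> h :: real)"
  shows "\<mu> = \<nu>"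
proof -
  interpret A: prob_space \<mu> by fact
  interpret B: prob_space \<nu> by fact
  obtain c where c: "c > 0" "\<And>x. c * norm x \<le> N x" using norm_le by blast
  \<comment> \<open>\<open>infdist x {}\<close> is 0 by convention, so the cut-offs do not detect
    the empty set; it is treated separately at the end.\<close>
  have closed_eq: "measure \<mu> C = measure \<nu> C" if C: "closed C" "C \<noteq> {}" for C
  proof -
    define h where "h k x = max 0 (1 - real (Suc k) * infdist x C)" for k x
    have [measurable]: "h k \<in> borel_measurable borel" for k
      unfolding h_def by (intro borel_measurable_continuous_onI continuous_intros)
    have lim: "(\<lambda>k. h k x) \<longlonglongrightarrow> indicator C x" for x
    proof (cases "x \<in> C")
      case False
      then have pos: "infdist x C > 0" using C by (simp add: infdist_pos_not_in_closed)
      obtain n where n: "1 < real n * infdist x C" using reals_Archimedean3[OF pos] by blast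
      have "h k x = 0" if "n \<le> k" for k
      proof -
        have "real n * infdist x C \<le> real (Suc k) * infdist x C" using pos that by (intro mult_right_mono) auto
        then show ?thesis using n by (simp add: h_def)
      qed
      then have "\<forall>\<^sub>F k in sequentially. h k x = 0" by (auto simp: eventually_sequentially)
      then show ?thesis using False by (simp add: tendsto_eventually)
    qed (simp add: h_def)
    have bd: "norm (h k x) \<le> 1" for k x by (simp add: h_def infdist_nonneg)
    have conv: "(\<lambda>k. integral\<^sup>L M (h k)) \<longlonglongrightarrow> measure M C"
      if M: "prob_space M" "sets M = sets borel" for M
    proof -
      interpret prob_space M by fact
      note M(2)[measurable_cong]
      have C': "C \<in> sets borel" using C by simp
      have "(\<lambda>k. integral\<^sup>L M (h k)) \<longlonglongrightarrow> integral\<^sup>L M (indicator C :: 'a \<Rightarrow> real)"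
        using C' bd lim by (intro integral_dominated_convergence[where w="\<lambda>_. 1"]) simp_all
      then show ?thesis using C' M(2) by simp
    qed
    have "integral\<^sup>L \<mu> (h k) = integral\<^sup>L \<nu> (h k)" for k
    proof (rule eq)
      show "real (Suc k) / c > 0" using c by simp
      fix x y
      have "\<bar>h k x - h k y\<bar> \<le> \<bar>real (Suc k) * infdist x C - real (Suc k) * infdist y C\<bar>"
        unfolding h_def by linarith
      also have "\<dots> = real (Suc k) * \<bar>infdist x C - infdist y C\<bar>"
        by (simp add: right_diff_distrib[symmetric] abs_mult)
      also have "\<dots> \<le> real (Suc k) * norm (x - y)"
        by (intro mult_left_mono) (use infdist_triangle_abs[of x C y] in \<open>simp_all add: dist_norm\<close>)
      also have "\<dots> \<le> real (Suc k) * (N (x - y) / c)"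
        using c by (intro mult_left_mono) (simp_all add: field_simps)
      finally show "\<bar>h k x - h k y\<bar> \<le> real (Suc k) / c * N (x - y)" by simp
    qed (simp_all add: h_def infdist_nonneg)
    with conv[OF \<mu>] conv[OF \<nu>] show ?thesis by (simp add: LIMSEQ_unique)
  qed
  show ?thesis
  proof (rule measure_eqI_generator_eq[where E="Collect closed" and \<Omega>=UNIV and A="\<lambda>_. UNIV"])
    show "Int_stable (Collect closed :: 'a set set)" by (auto simp: Int_stable_def)
    show "emeasure \<mu> C = emeasure \<nu> C" if "C \<in> Collect closed" for C
      using that closed_eq[of C] by (cases "C = {}") (auto simp: A.emeasure_eq_measure B.emeasure_eq_measure)
    show "sets \<mu> = sigma_sets UNIV (Collect closed)" "sets \<nu> = sigma_sets UNIV (Collect closed)"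
      by (simp_all add: \<mu> \<nu> borel_eq_closed)
  qed auto
qed

text \<open>Following \<open>\<Phi>\<close> by the push-forward under \<open>inv \<phi>\<close>
  gives a map \<open>\<Psi>\<close> that keeps all potentials. By hypothesis it keeps atoms, so it
  fixes countably supported measures; integrals of bounded Lipschitz functions carry this over to
  all of \<open>W2\<close>.\<close>

theorem isometrically_rigid_if_atoms_determined:
  assumes atoms: "\<And>\<mu> \<nu> x. \<mu> \<in> W2 \<Longrightarrow> \<nu> \<in> W2 \<Longrightarrow>
    (\<And>x. (\<integral>y. (N (x - y))\<^sup>2 \<partial>\<mu>) = (\<integral>y. (N (x - y))\<^sup>2 \<partial>\<nu>)) \<Longrightarrow> measure \<mu> {x} = measure \<nu> {x}"
  shows "isometrically_rigid 2 UNIV dist_N"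
  unfolding isometrically_rigid_def metric_borel_eq
proof (intro allI impI)
  fix \<Phi> assume \<Phi>: "isometry_of W2 W \<Phi>"
  have in_W2: "\<Phi> \<mu> \<in> W2" if "\<mu> \<in> W2" for \<mu>
    using \<Phi> that unfolding isometry_of_def by (auto intro: bij_betw_apply)
  have iso: "W (\<Phi> \<mu>) (\<Phi> \<nu>) = W \<mu> \<nu>" if "\<mu> \<in> W2" "\<nu> \<in> W2" for \<mu> \<nu>
    using \<Phi> that unfolding isometry_of_def by blast
  obtain \<phi> where \<phi>: "isometry_of UNIV dist_N \<phi>" "\<And>x. \<Phi> (return borel x) = return borel (\<phi> x)"
    using isometry_maps_returns[OF \<Phi>] by blast
  define \<psi> where "\<psi> = inv \<phi>"
  note \<psi> = isometry_inv[OF \<phi>(1), folded \<psi>_def]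
  have [measurable]: "\<phi> \<in> borel_measurable borel" "\<psi> \<in> borel_measurable borel"
    using \<phi>(1) \<psi>(1) by (auto intro: isometry_borel_measurable)
  have d\<phi>: "N (\<phi> x - \<phi> y) = N (x - y)" and d\<psi>: "N (\<psi> x - \<psi> y) = N (x - y)" for x y
    using \<phi>(1) \<psi>(1) unfolding isometry_of_def by auto
  define \<Psi> where "\<Psi> \<mu> = distr (\<Phi> \<mu>) borel \<psi>" for \<mu>
  have \<Psi>_in: "\<Psi> \<mu> \<in> W2" if "\<mu> \<in> W2" for \<mu>
    unfolding \<Psi>_def using d\<psi>[of _ 0]
    by (intro distr_in_W2[OF in_W2[OF that], of \<psi> "\<psi> 0" 0 1 0]) simp_all
  have \<Psi>_integral: "integral\<^sup>L (\<Psi> \<mu>) g = (\<integral>y. g (\<psi> y) \<partial>\<Phi> \<mu>)"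
    if "\<mu> \<in> W2" and [measurable]: "g \<in> borel_measurable borel" for \<mu> and g :: "'a \<Rightarrow> real"
  proof -
    note W2_sets[OF in_W2[OF that(1)], measurable_cong]
    show ?thesis unfolding \<Psi>_def by (rule integral_distr) measurable
  qed
  have pot: "(\<integral>y. (N (x - y))\<^sup>2 \<partial>\<Psi> \<mu>) = (\<integral>y. (N (x - y))\<^sup>2 \<partial>\<mu>)" if \<mu>: "\<mu> \<in> W2" for \<mu> x
  proof -
    have "N (x - \<psi> y) = N (\<phi> x - y)" for y using d\<phi>[of x "\<psi> y"] by (simp add: \<psi>)
    then have "(\<integral>y. (N (x - y))\<^sup>2 \<partial>\<Psi> \<mu>) = (\<integral>y. (N (\<phi> x - y))\<^sup>2 \<partial>\<Phi> \<mu>)"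
      by (simp add: \<Psi>_integral[OF \<mu>])
    also have "\<dots> = (\<integral>y. (N (x - y))\<^sup>2 \<partial>\<mu>)"
      using iso[OF return_in_W2 \<mu>, of x]
      unfolding \<phi>(2) W_return_left[OF \<mu>] W_return_left[OF in_W2[OF \<mu>]] by simp
    finally show ?thesis .
  qed
  have discrete: "\<Psi> \<sigma> = \<sigma>" if \<sigma>: "\<sigma> \<in> W2" "countable S" "AE x in \<sigma>. x \<in> S" for \<sigma> S
    by (rule prob_measures_eqI_atoms[symmetric, OF W2_prob[OF \<sigma>(1)] W2_sets[OF \<sigma>(1)]
        W2_prob[OF \<Psi>_in[OF \<sigma>(1)]] W2_sets[OF \<Psi>_in[OF \<sigma>(1)]] \<sigma>(2,3)])
       (rule atoms[OF \<sigma>(1) \<Psi>_in[OF \<sigma>(1)]], rule pot[OF \<sigma>(1), symmetric])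
  have "\<Psi> \<mu> = \<mu>" if \<mu>: "\<mu> \<in> W2" for \<mu>
  proof (rule prob_measures_eqI_Lipschitz[OF W2_prob[OF \<Psi>_in[OF \<mu>]] W2_sets[OF \<Psi>_in[OF \<mu>]] W2_prob[OF \<mu>] W2_sets[OF \<mu>]])
    fix h :: "'a \<Rightarrow> real" and L :: real
    assume h[measurable]: "h \<in> borel_measurable borel" and L: "L > 0" "\<And>x y. \<bar>h x - h y\<bar> \<le> L * N (x - y)"
      and bd: "\<And>x. 0 \<le> h x \<and> h x \<le> 1"
    have int: "integrable \<nu> g" if \<nu>: "\<nu> \<in> W2" and g: "g \<in> borel_measurable borel" "\<And>x. 0 \<le> g x \<and> g x \<le> (1::real)" for \<nu> g
    proof -
      interpret prob_space \<nu> using \<nu> by (rule W2_prob)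
      note g(1)[measurable] W2_sets[OF \<nu>, measurable_cong]
      show ?thesis using g(2) by (intro integrable_const_bound[where B=1]) auto
    qed
    have "\<bar>integral\<^sup>L (\<Psi> \<mu>) h - integral\<^sup>L \<mu> h\<bar> \<le> \<epsilon>" if "\<epsilon> > 0" for \<epsilon>
    proof -
      \<comment> \<open>Estimate through a countably supported \<open>\<sigma>\<close>:
        \<open>h\<close> is compared between \<open>\<mu>\<close> and \<open>\<sigma>\<close>, and
        \<open>h \<circ> \<psi>\<close> between \<open>\<Phi> \<mu>\<close> and
        \<open>\<Phi> \<sigma>\<close>, which are equally close. Each comparison costs at most
        \<open>L * W \<mu> \<sigma> \<le> \<epsilon> / 2\<close>, and the middle terms agree since
        \<open>\<Psi> \<sigma> = \<sigma>\<close>.\<close>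
      have "\<epsilon> / (2 * L) > 0" using that L by simp
      then obtain \<sigma> S where \<sigma>: "\<sigma> \<in> W2" "countable S" "AE x in \<sigma>. x \<in> S" "W \<mu> \<sigma> \<le> \<epsilon> / (2 * L)"
        using W2_discrete_approximation[OF \<mu>] by blast
      have h\<psi>: "(\<lambda>y. h (\<psi> y)) \<in> borel_measurable borel" by measurable
      have "\<bar>h (\<psi> x) - h (\<psi> y)\<bar> \<le> L * N (x - y)" for x y using L(2)[of "\<psi> x" "\<psi> y"] by (simp add: d\<psi>)
      note W_Lipschitz[OF in_W2[OF \<mu>] in_W2[OF \<sigma>(1)] L(1) this h\<psi> int[OF in_W2[OF \<mu>] h\<psi> bd] int[OF in_W2[OF \<sigma>(1)] h\<psi> bd]]
      moreover note W_Lipschitz[OF \<mu> \<sigma>(1) L h int[OF \<mu> h bd] int[OF \<sigma>(1) h bd]]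
      moreover have "integral\<^sup>L \<sigma> h = (\<integral>y. h (\<psi> y) \<partial>\<Phi> \<sigma>)"
        using \<Psi>_integral[OF \<sigma>(1), of h] discrete[OF \<sigma>(1-3)] by simp
      moreover have "L * W \<mu> \<sigma> \<le> \<epsilon> / 2" using \<sigma>(4) L(1) by (simp add: field_simps)
      ultimately show ?thesis using iso[OF \<mu> \<sigma>(1)] \<Psi>_integral[OF \<mu>, of h] by simp
    qed
    then have "\<bar>integral\<^sup>L (\<Psi> \<mu>) h - integral\<^sup>L \<mu> h\<bar> \<le> 0" by (rule field_le_epsilon[where y=0, simplified])
    then show "integral\<^sup>L (\<Psi> \<mu>) h = integral\<^sup>L \<mu> h" by simp
  qed
  moreover have "distr (\<Psi> \<mu>) borel \<phi> = \<Phi> \<mu>" if "\<mu> \<in> W2" for \<mu>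
  proof -
    note s = W2_sets[OF in_W2[OF that]]
    note s[measurable_cong]
    have "distr (\<Psi> \<mu>) borel \<phi> = distr (\<Phi> \<mu>) borel (\<lambda>x. x)"
      unfolding \<Psi>_def by (subst distr_distr) (auto simp: comp_def \<psi>)
    also have "\<dots> = \<Phi> \<mu>" by (rule distr_id2) (simp add: s)
    finally show ?thesis .
  qed
  ultimately have "\<forall>\<mu>\<in>W2. \<Phi> \<mu> = distr \<mu> borel \<phi>" by metis
  with \<phi>(1) show "\<exists>\<phi>. isometry_of UNIV dist_N \<phi> \<and> (\<forall>\<mu>\<in>W2. \<Phi> \<mu> = distr \<mu> borel \<phi>)" by blast
qed

text \<open>\<open>cs\<close> lists coefficients and shifts, so \<open>K\<close> is a finite
  combination of translates of the squared norm. By homogeneity its integral, magnified about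
  \<open>x\<close> by \<open>k\<close>, is \<open>k\<^sup>2\<close> times a combination of values of
  the potential, hence the same for both measures. Magnification pushes each
  \<open>y \<noteq> x\<close> to infinity, where \<open>K\<close> vanishes; only the mass at
  \<open>x\<close> survives, with weight \<open>K 0\<close>.\<close>

lemma measure_singleton_eqI:
  fixes cs :: "(real \<times> 'a) list"
  defines "K z \<equiv> \<Sum>(c, w)\<leftarrow>cs. c * (N (z + w))\<^sup>2"
  assumes \<mu>: "\<mu> \<in> W2" and \<nu>: "\<nu> \<in> W2"
    and pot: "\<And>x. (\<integral>y. (N (x - y))\<^sup>2 \<partial>\<mu>) = (\<integral>y. (N (x - y))\<^sup>2 \<partial>\<nu>)"
    and lim: "(K \<longlongrightarrow> 0) at_infinity" and "K 0 \<noteq> 0"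
  shows "measure \<mu> {x} = measure \<nu> {x}"
proof -
  define k where "k n = real (Suc n)" for n
  have kpos: "k n > 0" for n by (simp add: k_def)
  have eq: "(N (k n *\<^sub>R (x - y) + w))\<^sup>2 = (k n)\<^sup>2 * (N ((x + w /\<^sub>R k n) - y))\<^sup>2" for n y w
  proof -
    have "k n *\<^sub>R (x - y) + w = k n *\<^sub>R ((x + w /\<^sub>R k n) - y)"
      using kpos[of n] by (simp add: algebra_simps)
    then show ?thesis using kpos[of n] by (simp add: scale power_mult_distrib)
  qed
  have int: "integrable M (\<lambda>y. (N (k n *\<^sub>R (x - y) + w))\<^sup>2)" if "M \<in> W2" for M n w
    unfolding eq using W2_integrable[OF that] by simp
  have expand: "(\<integral>y. (\<Sum>(c, w)\<leftarrow>ds. c * (N (k n *\<^sub>R (x - y) + w))\<^sup>2) \<partial>M) =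
      (\<Sum>(c, w)\<leftarrow>ds. c * (\<integral>y. (N (k n *\<^sub>R (x - y) + w))\<^sup>2 \<partial>M)) \<and>
      integrable M (\<lambda>y. \<Sum>(c, w)\<leftarrow>ds. c * (N (k n *\<^sub>R (x - y) + w))\<^sup>2)" if "M \<in> W2" for M n ds
    by (induction ds) (use int[OF that] in auto)
  have same: "(\<integral>y. K (k n *\<^sub>R (x - y)) \<partial>\<mu>) = (\<integral>y. K (k n *\<^sub>R (x - y)) \<partial>\<nu>)" for n
    unfolding K_def conjunct1[OF expand[OF \<mu>]] conjunct1[OF expand[OF \<nu>]] by (simp add: eq pot)
  have cont: "continuous_on S K" for S
    unfolding K_def by (induction cs) (auto intro!: continuous_intros)
  then have [measurable]: "K \<in> borel_measurable borel" by (rule borel_measurable_continuous_onI)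
  \<comment> \<open>A dominating constant: \<open>K\<close> is below 1 in absolute value outside a
    ball and bounded on the ball by compactness.\<close>
  obtain B where B: "\<And>z. norm (K z) \<le> B"
  proof -
    have "\<forall>\<^sub>F z in at_infinity. norm (K z) < 1" using lim by (auto dest: tendstoD[of _ _ _ 1] simp: dist_norm)
    then obtain b where b: "\<And>z. b \<le> norm z \<Longrightarrow> norm (K z) < 1" unfolding eventually_at_infinity by blast
    have "bounded (K ` cball 0 b)" by (intro compact_imp_bounded compact_continuous_image cont) simp
    then obtain b' where "\<forall>z\<in>cball 0 b. norm (K z) \<le> b'" unfolding bounded_iff by blast
    then have b': "norm (K z) \<le> b'" if "norm z \<le> b" for z using that by simp
    have "norm (K z) \<le> max 1 b'" for z using b[of z] b'[of z] by linarith
    then show ?thesis by (rule that)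
  qed
  have lim_K: "(\<lambda>n. K (k n *\<^sub>R (x - y))) \<longlonglongrightarrow> K 0 * indicator {x} y" for y
  proof (cases "y = x")
    case False
    have "filterlim k at_top sequentially" unfolding k_def
      using filterlim_compose[OF filterlim_real_sequentially filterlim_Suc] .
    then have "filterlim (\<lambda>n. k n *\<^sub>R (x - y)) at_infinity sequentially"
      using False by (auto simp: filterlim_at_infinity_conv_norm_at_top abs_of_pos[OF kpos]
          intro!: filterlim_at_top_mult_tendsto_pos[OF tendsto_const] less_imp_le)
    then have "(\<lambda>n. K (k n *\<^sub>R (x - y))) \<longlonglongrightarrow> 0" by (rule filterlim_compose[OF lim])
    then show ?thesis using False by simp
  qed simp
  have conv: "(\<lambda>n. \<integral>y. K (k n *\<^sub>R (x - y)) \<partial>M) \<longlonglongrightarrow> K 0 * measure M {x}" if M: "M \<in> W2" for M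
  proof -
    interpret prob_space M using M by (rule W2_prob)
    note W2_sets[OF M, measurable_cong]
    have "(\<lambda>n. \<integral>y. K (k n *\<^sub>R (x - y)) \<partial>M) \<longlonglongrightarrow> (\<integral>y. K 0 * indicator {x} y \<partial>M)"
      using lim_K B by (intro integral_dominated_convergence[where w="\<lambda>_. B"]) simp_all
    then show ?thesis by (simp add: W2_sets[OF M])
  qed
  from conv[OF \<mu>] conv[OF \<nu>] have "K 0 * measure \<mu> {x} = K 0 * measure \<nu> {x}"
    unfolding same by (rule LIMSEQ_unique)
  then show ?thesis using \<open>K 0 \<noteq> 0\<close> by simp
qed

end

section \<open>The \<open>l\<^sub>q\<close> norm\<close>

lemma DERIV_abs_powr:
  fixes t p :: real
  assumes "p > 1"
  shows "((\<lambda>t. \<bar>t\<bar> powr p) has_real_derivative p * (sgn t * \<bar>t\<bar> powr (p - 1))) (at t)"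
    and "((\<lambda>t. sgn t * \<bar>t\<bar> powr p) has_real_derivative p * \<bar>t\<bar> powr (p - 1)) (at t)"
proof -
  consider "t > 0" | "t < 0" | "t = 0" by linarith
  then have "((\<lambda>t. \<bar>t\<bar> powr p) has_real_derivative p * (sgn t * \<bar>t\<bar> powr (p - 1))) (at t) \<and>
    ((\<lambda>t. sgn t * \<bar>t\<bar> powr p) has_real_derivative p * \<bar>t\<bar> powr (p - 1)) (at t)"
  proof cases
    case 1
    have *: "((\<lambda>t. t powr p) has_real_derivative p * t powr (p - 1)) (at t)"
      using 1 by (auto intro!: derivative_eq_intros)
    have "\<forall>\<^sub>F x in nhds t. x > 0" using 1 by (simp add: eventually_nhds_in_open[of "{0<..}", simplified])
    then have "\<forall>\<^sub>F x in nhds t. \<bar>x\<bar> powr p = x powr p" "\<forall>\<^sub>F x in nhds t. sgn x * \<bar>x\<bar> powr p = x powr p"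
      by (auto elim: eventually_mono)
    with * 1 show ?thesis by (auto simp: DERIV_cong_ev)
  next
    case 2
    have *: "((\<lambda>t. (- t) powr p) has_real_derivative - (p * (- t) powr (p - 1))) (at t)"
      using 2 by (auto intro!: derivative_eq_intros)
    note minus = DERIV_minus[OF *]
    have "\<forall>\<^sub>F x in nhds t. x < 0" using 2 by (simp add: eventually_nhds_in_open[of "{..<0}", simplified])
    then have "\<forall>\<^sub>F x in nhds t. \<bar>x\<bar> powr p = (- x) powr p" "\<forall>\<^sub>F x in nhds t. sgn x * \<bar>x\<bar> powr p = - ((- x) powr p)"
      by (auto elim: eventually_mono)
    with * minus 2 show ?thesis by (auto simp: DERIV_cong_ev)
  next
    case 3
    \<comment> \<open>At the origin both difference quotients have absolute value
      \<open>\<bar>h\<bar> powr (p - 1)\<close>, which tends to 0 because \<open>p > 1\<close>. This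
      agrees with the claimed derivatives, since \<open>0 powr (p - 1)\<close> is 0.\<close>
    have lim: "((\<lambda>h. \<bar>h\<bar> powr (p - 1)) \<longlongrightarrow> 0) (at (0::real))"
      using assms by (auto intro!: tendsto_eq_intros)
    have q: "\<bar>h\<bar> powr p / h = sgn h * \<bar>h\<bar> powr (p - 1)" "sgn h * \<bar>h\<bar> powr p / h = \<bar>h\<bar> powr (p - 1)" if "h \<noteq> 0" for h :: real
      using that by (auto simp: powr_diff sgn_real_def field_simps)
    have "((\<lambda>h. sgn h * \<bar>h\<bar> powr (p - 1)) \<longlongrightarrow> 0) (at (0::real))"
      by (rule Lim_null_comparison[OF _ lim]) (simp add: abs_mult abs_sgn_eq)
    with lim 3 show ?thesis unfolding DERIV_def
      by (auto simp: q cong: LIM_cong)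
  qed
  then show "((\<lambda>t. \<bar>t\<bar> powr p) has_real_derivative p * (sgn t * \<bar>t\<bar> powr (p - 1))) (at t)"
    "((\<lambda>t. sgn t * \<bar>t\<bar> powr p) has_real_derivative p * \<bar>t\<bar> powr (p - 1)) (at t)" by auto
qed

lemma convex_on_abs_powr:
  fixes p :: real
  assumes "p > 1"
  shows "convex_on UNIV (\<lambda>t::real. \<bar>t\<bar> powr p)"
proof (rule convex_on_realI)
  show "((\<lambda>t. \<bar>t\<bar> powr p) has_real_derivative p * (sgn t * \<bar>t\<bar> powr (p - 1))) (at t)" for t
    by (rule DERIV_abs_powr[OF assms])
  fix x y :: real assume "x \<le> y"
  have "\<bar>x\<bar> powr (p - 1) \<le> \<bar>y\<bar> powr (p - 1)" if "0 \<le> x" using that \<open>x \<le> y\<close> assms by (intro powr_mono2) auto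
  moreover have "\<bar>y\<bar> powr (p - 1) \<le> \<bar>x\<bar> powr (p - 1)" if "y \<le> 0" using that \<open>x \<le> y\<close> assms by (intro powr_mono2) auto
  ultimately show "p * (sgn x * \<bar>x\<bar> powr (p - 1)) \<le> p * (sgn y * \<bar>y\<bar> powr (p - 1))"
    using assms \<open>x \<le> y\<close> by (intro mult_left_mono) (auto simp: sgn_real_def intro: order_trans[of _ 0])
qed simp

lemma lq_norm_powr: "q \<noteq> 0 \<Longrightarrow> lq_norm q x powr q = (\<Sum>i\<in>UNIV. \<bar>x $ i\<bar> powr q)"
  unfolding lq_norm_def by (simp add: powr_powr sum_nonneg)

text \<open>The triangle inequality is convexity of \<open>\<bar>t\<bar> powr q\<close> applied to
  normalised vectors: with \<open>a\<close> and \<open>b\<close> the two norms,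
  \<open>(x + y) / (a + b)\<close> is the convex combination of \<open>x / a\<close> and
  \<open>y / b\<close> with weights \<open>a / (a + b)\<close> and
  \<open>b / (a + b)\<close>.\<close>

lemma norm_functional_lq_norm:
  assumes q: "q > 1"
  shows "norm_functional (lq_norm q :: real ^ 'n::finite \<Rightarrow> real)"
proof
  let ?N = "lq_norm q :: real ^ 'n \<Rightarrow> real"
  have nonneg: "?N x \<ge> 0" for x by (simp add: lq_norm_def)
  show scale: "?N (c *\<^sub>R x) = \<bar>c\<bar> * ?N x" for c x
    using q unfolding lq_norm_def
    by (simp add: abs_mult powr_mult sum_distrib_left[symmetric] sum_nonneg powr_powr)
  show definite: "x = 0" if "?N x = 0" for x
    using that q unfolding lq_norm_def by (simp add: sum_nonneg_eq_0_iff vec_eq_iff)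
  show "?N (x + y) \<le> ?N x + ?N y" for x y
  proof (cases "x = 0 \<or> y = 0")
    case True
    then show ?thesis using nonneg by auto
  next
    case False
    define a b where "a = ?N x" and "b = ?N y"
    have ab: "a > 0" "b > 0" using False definite nonneg by (auto simp: a_def b_def less_le)
    define t where "t = b / (a + b)"
    have t: "0 \<le> t" "t \<le> 1" "1 - t = a / (a + b)" using ab by (auto simp: t_def field_simps)
    have "\<bar>(x + y) $ i\<bar> powr q \<le> (a + b) powr q * ((1 - t) * (\<bar>x $ i\<bar> powr q / a powr q) + t * (\<bar>y $ i\<bar> powr q / b powr q))" for i
    proof -
      have "(a + b) * (1 - t) = a" "(a + b) * t = b" using ab by (auto simp: t_def field_simps)
      then have "(a + b) * ((1 - t) * (x $ i / a) + t * (y $ i / b)) = a * (x $ i / a) + b * (y $ i / b)"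
        by (metis distrib_left mult.assoc)
      then have "(x + y) $ i = (a + b) * ((1 - t) * (x $ i / a) + t * (y $ i / b))"
        using ab by simp
      then have "\<bar>(x + y) $ i\<bar> powr q = (a + b) powr q * \<bar>(1 - t) * (x $ i / a) + t * (y $ i / b)\<bar> powr q"
        using ab by (simp add: abs_mult powr_mult)
      also have "\<dots> \<le> (a + b) powr q * ((1 - t) * \<bar>x $ i / a\<bar> powr q + t * \<bar>y $ i / b\<bar> powr q)"
        using convex_onD[OF convex_on_abs_powr[OF q] t(1,2), of "x $ i / a" "y $ i / b"] by (intro mult_left_mono) auto
      finally show ?thesis using ab by (simp add: powr_divide)
    qed
    then have "(\<Sum>i\<in>UNIV. \<bar>(x + y) $ i\<bar> powr q) \<le>
        (\<Sum>i\<in>UNIV. (a + b) powr q * ((1 - t) * (\<bar>x $ i\<bar> powr q / a powr q) + t * (\<bar>y $ i\<bar> powr q / b powr q)))"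
      by (rule sum_mono)
    also have "\<dots> = (a + b) powr q * ((1 - t) * ((\<Sum>i\<in>UNIV. \<bar>x $ i\<bar> powr q) / a powr q) + t * ((\<Sum>i\<in>UNIV. \<bar>y $ i\<bar> powr q) / b powr q))"
      by (simp add: sum_distrib_left[symmetric] sum.distrib sum_divide_distrib[symmetric])
    also have "\<dots> = (a + b) powr q"
      using q ab lq_norm_powr[of q x, symmetric] lq_norm_powr[of q y, symmetric] by (simp add: a_def b_def)
    finally have "?N (x + y) \<le> ((a + b) powr q) powr (1 / q)"
      using q unfolding lq_norm_def by (intro powr_mono2) (auto intro: sum_nonneg)
    then show ?thesis using q ab by (simp add: powr_powr a_def b_def)
  qed
qed

text \<open>The second derivative of \<open>(lq_norm q z)\<^sup>2\<close> in the direction of axis \<open>j\<close> depends only on the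
  ratio \<open>u = \<bar>z $ j\<bar> / lq_norm q z\<close>, through the following function; for \<open>q > 2\<close> it is continuous at \<open>0\<close>.\<close>

definition lq_hess :: "real \<Rightarrow> real \<Rightarrow> real" where
  "lq_hess q u = 2 * (q - 1) * u powr (q - 2) + 2 * (2 - q) * u powr (2 * q - 2)"

section \<open>Second derivatives of the squared norm along an axis\<close>

context
  fixes q :: real
  assumes q: "q > 2"
begin

interpretation norm_functional "lq_norm q :: real ^ 'n::finite \<Rightarrow> real"
  using q by (intro norm_functional_lq_norm) simp

lemma component_le_lq_norm: "\<bar>z $ j\<bar> \<le> lq_norm q (z :: real ^ 'n)"
proof -
  have "\<bar>z $ j\<bar> = (\<bar>z $ j\<bar> powr q) powr (1 / q)" using q by (simp add: powr_powr)
  also have "\<dots> \<le> lq_norm q z"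
    unfolding lq_norm_def using q by (intro powr_mono2 member_le_sum) auto
  finally show ?thesis .
qed

lemma lq_norm_axis: "lq_norm q (axis j 1 :: real ^ 'n) = 1"
proof -
  have "(\<Sum>i\<in>UNIV. \<bar>axis j (1::real) $ i\<bar> powr q) = (\<Sum>i\<in>UNIV. if i = j then 1 else 0)"
    using q by (intro sum.cong) (auto simp: axis_def)
  then show ?thesis unfolding lq_norm_def by simp
qed

text \<open>Along a line parallel to axis \<open>j\<close> a single summand varies and the rest is
  the constant \<open>S z j\<close>, so calculus in one variable suffices.\<close>

lemma lq_norm_sq_line:
  defines "S z j \<equiv> \<Sum>i\<in>UNIV - {j}. \<bar>z $ i\<bar> powr q"
  shows "(lq_norm q (z + t *\<^sub>R axis j 1 :: real ^ 'n))\<^sup>2 = (\<bar>z $ j + t\<bar> powr q + S z j) powr (2 / q)"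
    and "lq_norm q (z + t *\<^sub>R axis j 1 :: real ^ 'n) = (\<bar>z $ j + t\<bar> powr q + S z j) powr (1 / q)"
proof -
  have "(\<Sum>i\<in>UNIV. \<bar>(z + t *\<^sub>R axis j 1) $ i\<bar> powr q) = \<bar>z $ j + t\<bar> powr q + S z j"
    unfolding S_def by (subst sum.remove[of UNIV j]) (auto simp: axis_def intro!: sum.cong)
  then show *: "lq_norm q (z + t *\<^sub>R axis j 1) = (\<bar>z $ j + t\<bar> powr q + S z j) powr (1 / q)"
    unfolding lq_norm_def by simp
  show "(lq_norm q (z + t *\<^sub>R axis j 1))\<^sup>2 = (\<bar>z $ j + t\<bar> powr q + S z j) powr (2 / q)"
    unfolding * by (simp add: power2_eq_square powr_add[symmetric])
qed

lemma DERIV_lq_norm_sq_line: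
  fixes b s :: real
  defines "T \<equiv> \<lambda>s. \<bar>s\<bar> powr q + b"
  assumes T: "T s > 0"
  shows "((\<lambda>s. T s powr (2 / q)) has_real_derivative
      2 * (T s powr (2 / q - 1) * (sgn s * \<bar>s\<bar> powr (q - 1)))) (at s)"
    and "((\<lambda>s. 2 * (T s powr (2 / q - 1) * (sgn s * \<bar>s\<bar> powr (q - 1)))) has_real_derivative
      lq_hess q (\<bar>s\<bar> / T s powr (1 / q))) (at s)"
proof -
  have dT: "(T has_real_derivative q * (sgn s * \<bar>s\<bar> powr (q - 1))) (at s)"
    unfolding T_def using DERIV_add[OF DERIV_abs_powr(1)[of q s] DERIV_const[of b]] q by simp
  note dp = DERIV_fun_powr[OF dT T]
  show "((\<lambda>s. T s powr (2 / q)) has_real_derivative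
      2 * (T s powr (2 / q - 1) * (sgn s * \<bar>s\<bar> powr (q - 1)))) (at s)"
    using dp[of "2 / q"] q by (simp add: mult_ac)
  have ds: "((\<lambda>s. sgn s * \<bar>s\<bar> powr (q - 1)) has_real_derivative (q - 1) * \<bar>s\<bar> powr (q - 2)) (at s)"
    using DERIV_abs_powr(2)[of "q - 1" s] q by simp
  have "(\<bar>s\<bar> / T s powr (1 / q)) powr (q - 2) = \<bar>s\<bar> powr (q - 2) * T s powr (2 / q - 1)"
    and "(\<bar>s\<bar> / T s powr (1 / q)) powr (2 * q - 2) = \<bar>s\<bar> powr (2 * q - 2) * T s powr (2 / q - 2)"
  proof -
    \<comment> \<open>Homogeneity of degree 0: the exponents of \<open>T\<close> are those that
      combine with the powers of \<open>\<bar>s\<bar>\<close> into powers of the ratio.\<close>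
    have "2 / q - 1 = - (1 / q * (q - 2))" "2 / q - 2 = - (1 / q * (2 * q - 2))" using q by (simp_all add: field_simps)
    then show "(\<bar>s\<bar> / T s powr (1 / q)) powr (q - 2) = \<bar>s\<bar> powr (q - 2) * T s powr (2 / q - 1)"
      "(\<bar>s\<bar> / T s powr (1 / q)) powr (2 * q - 2) = \<bar>s\<bar> powr (2 * q - 2) * T s powr (2 / q - 2)"
      by (simp_all only: powr_divide powr_powr powr_minus_divide times_divide_eq_right mult_1_right)
  qed
  then have h: "lq_hess q (\<bar>s\<bar> / T s powr (1 / q)) =
      2 * (q - 1) * (\<bar>s\<bar> powr (q - 2) * T s powr (2 / q - 1)) +
      2 * (2 - q) * (\<bar>s\<bar> powr (2 * q - 2) * T s powr (2 / q - 2))"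
    unfolding lq_hess_def by simp
  have e: "(sgn s * \<bar>s\<bar> powr (q - 1)) * (sgn s * \<bar>s\<bar> powr (q - 1)) = \<bar>s\<bar> powr (2 * q - 2)"
    by (cases "s = 0") (auto simp: sgn_real_def powr_add[symmetric])
  \<comment> \<open>The term of the product rule in which \<open>T s powr (2 / q - 1)\<close> is
    differentiated; its coefficient comes from \<open>(2 / q - 1) * q = 2 - q\<close>.\<close>
  have "2 * ((2 / q - 1) * T s powr (2 / q - 1 - real 1) * (q * (sgn s * \<bar>s\<bar> powr (q - 1))) * (sgn s * \<bar>s\<bar> powr (q - 1)))
     = 2 * ((2 / q - 1) * q) * T s powr (2 / q - 2) * ((sgn s * \<bar>s\<bar> powr (q - 1)) * (sgn s * \<bar>s\<bar> powr (q - 1)))"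
    by (simp add: mult_ac)
  also have "\<dots> = 2 * (2 - q) * (\<bar>s\<bar> powr (2 * q - 2) * T s powr (2 / q - 2))"
    unfolding e using q by (simp add: field_simps)
  finally have e': "2 * ((2 / q - 1) * T s powr (2 / q - 1 - real 1) * (q * (sgn s * \<bar>s\<bar> powr (q - 1))) * (sgn s * \<bar>s\<bar> powr (q - 1))) =
    2 * (2 - q) * (\<bar>s\<bar> powr (2 * q - 2) * T s powr (2 / q - 2))" .
  show "((\<lambda>s. 2 * (T s powr (2 / q - 1) * (sgn s * \<bar>s\<bar> powr (q - 1)))) has_real_derivative
      lq_hess q (\<bar>s\<bar> / T s powr (1 / q))) (at s)"
    by (rule DERIV_cong[OF DERIV_cmult[OF DERIV_mult[OF dp[of "2 / q - 1"] ds], of 2]], unfold h distrib_left e')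
       (simp only: mult_ac add_ac)
qed

text \<open>Second-order Taylor expansion in both directions: the first-order terms cancel, and each
  direction leaves half a second derivative at its own intermediate point. A norm above 1 keeps the
  segment between \<open>z - e\<close> and \<open>z + e\<close> away from the origin.\<close>

lemma lq_norm_sq_second_difference:
  fixes z :: "real ^ 'n" and j :: 'n
  defines "e \<equiv> axis j 1 :: real ^ 'n"
  assumes z: "lq_norm q z > 1"
  obtains s t where "\<bar>s\<bar> \<le> 1" "\<bar>t\<bar> \<le> 1"
    "(lq_norm q (z + e))\<^sup>2 + (lq_norm q (z - e))\<^sup>2 - 2 * (lq_norm q z)\<^sup>2 =
      lq_hess q (\<bar>(z + s *\<^sub>R e) $ j\<bar> / lq_norm q (z + s *\<^sub>R e)) / 2 +
      lq_hess q (\<bar>(z + t *\<^sub>R e) $ j\<bar> / lq_norm q (z + t *\<^sub>R e)) / 2"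
proof -
  let ?N = "lq_norm q :: real ^ 'n \<Rightarrow> real"
  define b where "b = (\<Sum>i\<in>UNIV - {j}. \<bar>z $ i\<bar> powr q)"
  define T where "T s = \<bar>s\<bar> powr q + b" for s
  define F where "F t = T (z $ j + t) powr (2 / q)" for t
  define F' where "F' t = 2 * (T (z $ j + t) powr (2 / q - 1) * (sgn (z $ j + t) * \<bar>z $ j + t\<bar> powr (q - 1)))" for t
  define F'' where "F'' t = lq_hess q (\<bar>(z + t *\<^sub>R e) $ j\<bar> / ?N (z + t *\<^sub>R e))" for t
  have N: "?N (z + t *\<^sub>R e) = T (z $ j + t) powr (1 / q)" and N2: "(?N (z + t *\<^sub>R e))\<^sup>2 = F t" for t
    using lq_norm_sq_line[of z t j] by (simp_all add: e_def T_def F_def b_def)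
  have F'': "F'' t = lq_hess q (\<bar>z $ j + t\<bar> / T (z $ j + t) powr (1 / q))" for t
    unfolding F''_def N by (simp add: e_def)
  have pos: "T (z $ j + t) > 0" if "\<bar>t\<bar> \<le> 1" for t
  proof -
    have "?N z - \<bar>t\<bar> \<le> ?N (z + t *\<^sub>R e)"
      using reverse_triangle[of z "z + t *\<^sub>R e"] by (simp add: scale e_def lq_norm_axis)
    then have "T (z $ j + t) \<noteq> 0" using z that N[of t] by auto
    moreover have "T (z $ j + t) \<ge> 0" unfolding T_def b_def by (intro add_nonneg_nonneg sum_nonneg) auto
    ultimately show ?thesis by simp
  qed
  have shift: "((\<lambda>t. G (z $ j + t)) has_real_derivative d) (at t)"
    if "(G has_real_derivative d) (at (z $ j + t))" for G d t
    using that DERIV_shift[of G d t "z $ j"] by (simp add: add.commute)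
  note d = DERIV_lq_norm_sq_line[of _ b, folded T_def, OF pos]
  have d1: "(F has_real_derivative F' t) (at t)" and d2: "(F' has_real_derivative F'' t) (at t)" if "\<bar>t\<bar> \<le> 1" for t
    unfolding F_def F'_def F'' by (rule shift[OF d(1)[OF that]], rule shift[OF d(2)[OF that]])
  define D where "D m = (if m = 0 then F else if m = 1 then F' else F'')" for m :: nat
  have D: "\<forall>m t. m < 2 \<and> -1 \<le> t \<and> t \<le> 1 \<longrightarrow> DERIV (D m) t :> D (Suc m) t"
    using d1 d2 unfolding D_def by (auto simp: less_2_cases_iff)
  obtain s where s: "0 < s" "s < 1" "F 1 = F 0 + F' 0 + F'' s / 2"
    using Taylor_up[of 2 D F "-1" 1 0] D by (auto simp: D_def numeral_2_eq_2)
  obtain t where t: "-1 < t" "t < 0" "F (-1) = F 0 - F' 0 + F'' t / 2"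
    using Taylor_down[of 2 D F "-1" 1 0] D by (auto simp: D_def numeral_2_eq_2)
  have "F 1 = (?N (z + e))\<^sup>2" "F (-1) = (?N (z - e))\<^sup>2" "F 0 = (?N z)\<^sup>2"
    using N2[of 1] N2[of "-1"] N2[of 0] by simp_all
  with s t show ?thesis unfolding F''_def by (intro that[of s t]) auto
qed

text \<open>The ratio is homogeneous of degree 0, so a bounded shift changes it by order
  \<open>1 / lq_norm q z\<close>, and \<open>lq_hess q\<close> is uniformly continuous on
  \<open>{0..1}\<close>, where the ratios lie. The bound 2 leaves room for a unit shift along
  another axis followed by a move to a Taylor intermediate point.\<close>

lemma lq_hess_ratio_slowly_varying:
  fixes j :: "'n::finite"
  assumes "\<epsilon> > 0"
  obtains R where "R > 2" "\<And>z w :: real ^ 'n. lq_norm q z > R \<Longrightarrow> lq_norm q w \<le> 2 \<Longrightarrow>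
    \<bar>lq_hess q (\<bar>(z + w) $ j\<bar> / lq_norm q (z + w)) - lq_hess q (\<bar>z $ j\<bar> / lq_norm q z)\<bar> < \<epsilon>"
proof -
  let ?N = "lq_norm q :: real ^ 'n \<Rightarrow> real"
  have "continuous_on {0..1} (lq_hess q)"
    unfolding lq_hess_def using q by (intro continuous_intros continuous_on_powr') auto
  then have "uniformly_continuous_on {0..1} (lq_hess q)" by (rule compact_uniformly_continuous) simp
  from uniformly_continuous_onE[OF this \<open>\<epsilon> > 0\<close>]
  obtain \<delta> where \<delta>: "\<delta> > 0" "\<And>u v. u \<in> {0..1} \<Longrightarrow> v \<in> {0..1} \<Longrightarrow> \<bar>v - u\<bar> < \<delta> \<Longrightarrow> \<bar>lq_hess q v - lq_hess q u\<bar> < \<epsilon>"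
    unfolding dist_real_def by blast
  \<comment> \<open>After a shift of norm at most 2 the norm still exceeds
    \<open>4 / \<delta>\<close>. Numerator and denominator change by at most 2 each, so the ratio
    changes by less than \<open>\<delta>\<close>.\<close>
  define R where "R = 2 + 4 / \<delta>"
  show ?thesis
  proof (rule that)
    show "R > 2" using \<delta>(1) by (simp add: R_def)
    fix z w :: "real ^ 'n" assume z: "?N z > R" and w: "?N w \<le> 2"
    have zw: "?N (z + w) \<ge> ?N z - 2" using reverse_triangle[of z "z + w"] w by simp
    then have big: "?N (z + w) > 4 / \<delta>" using z by (simp add: R_def)
    have "4 / \<delta> > 0" using \<delta>(1) by simp
    then have pos: "?N z > 0" "?N (z + w) > 0" using z big unfolding R_def by linarith+
    let ?u = "\<bar>z $ j\<bar> / ?N z" and ?v = "\<bar>(z + w) $ j\<bar> / ?N (z + w)"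
    have u: "?u \<in> {0..1}" "?v \<in> {0..1}"
      using component_le_lq_norm[of z j] component_le_lq_norm[of "z + w" j] pos by auto
    \<comment> \<open>Multiplying by the new norm splits the change of the ratio into the change of
      the numerator and that of the denominator, the latter weighted by
      \<open>?u \<le> 1\<close>.\<close>
    have "?N (z + w) * (?v - ?u) = (?N (z + w) * ?v - ?N z * ?u) - ?u * (?N (z + w) - ?N z)"
      by (simp only: algebra_simps)
    also have "\<dots> = (\<bar>(z + w) $ j\<bar> - \<bar>z $ j\<bar>) - ?u * (?N (z + w) - ?N z)"
      using pos by (simp only: nonzero_mult_div_cancel_left times_divide_eq_right less_imp_neq[symmetric] not_False_eq_True)
    finally have "\<bar>?N (z + w) * (?v - ?u)\<bar> = \<bar>(\<bar>(z + w) $ j\<bar> - \<bar>z $ j\<bar>) - ?u * (?N (z + w) - ?N z)\<bar>" by simp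
    also have "\<dots> \<le> \<bar>\<bar>(z + w) $ j\<bar> - \<bar>z $ j\<bar>\<bar> + ?u * \<bar>?N (z + w) - ?N z\<bar>"
      using u(1) by (intro order_trans[OF abs_triangle_ineq4]) (simp add: abs_mult)
    also have "\<dots> \<le> ?N w + 1 * ?N w"
      using u(1) component_le_lq_norm[of w j] reverse_triangle[of "z + w" z]
      by (intro add_mono mult_mono) auto
    finally have "?N (z + w) * \<bar>?v - ?u\<bar> \<le> 4" using w pos by (simp add: abs_mult)
    then have "\<bar>?v - ?u\<bar> \<le> 4 / ?N (z + w)" using pos by (simp add: field_simps)
    also have "\<dots> < \<delta>" using big pos \<delta>(1) by (simp add: field_simps)
    finally show "\<bar>lq_hess q ?v - lq_hess q ?u\<bar> < \<epsilon>" by (rule \<delta>(2)[OF u])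
  qed
qed

text \<open>At infinity the second difference \<open>\<Delta>\<close> follows a function
  \<open>g\<close> that depends on the direction and has no limit; subtracting a copy shifted along
  a second axis removes it. On the line the squared norm is a quadratic polynomial with constant
  second differences, so the subtraction would leave nothing at 0 either.\<close>

theorem isometrically_rigid_lq:
  assumes card: "CARD('n::finite) \<ge> 2"
  shows "isometrically_rigid 2 UNIV (lq_dist q :: real ^ 'n \<Rightarrow> real ^ 'n \<Rightarrow> real)"
proof -
  let ?N = "lq_norm q :: real ^ 'n \<Rightarrow> real"
  obtain j i :: 'n where ij: "j \<noteq> i"
    using card by (metis card_2_iff' card_le_Suc0_iff_eq finite not_less_eq_eq numeral_2_eq_2 UNIV_I)
  define e e' :: "real ^ 'n" where "e = axis j 1" and "e' = axis i 1"
  define \<Delta> where "\<Delta> z = (?N (z + e))\<^sup>2 + (?N (z - e))\<^sup>2 - 2 * (?N z)\<^sup>2" for z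
  \<comment> \<open>Coefficients and shifts of \<open>\<Delta> z - \<Delta> (z + e')\<close>,
    expanded into six translates.\<close>
  define cs :: "(real \<times> (real ^ 'n)) list"
    where "cs = [(1, e), (1, - e), (- 2, 0), (- 1, e' + e), (- 1, e' - e), (2, e')]"
  have K: "(\<Sum>(c, w)\<leftarrow>cs. c * (?N (z + w))\<^sup>2) = \<Delta> z - \<Delta> (z + e')" for z
    by (simp add: cs_def \<Delta>_def add.assoc add_diff_eq)
  have lim: "((\<lambda>z. \<Sum>(c, w)\<leftarrow>cs. c * (?N (z + w))\<^sup>2) \<longlongrightarrow> 0) at_infinity"
    unfolding K
  proof (rule tendstoI)
    fix \<epsilon> :: real assume "\<epsilon> > 0"
    define g where "g z = lq_hess q (\<bar>z $ j\<bar> / ?N z)" for z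
    have "\<epsilon> / 2 > 0" using \<open>\<epsilon> > 0\<close> by simp
    then obtain R where R: "R > 2" "\<And>z w. ?N z > R \<Longrightarrow> ?N w \<le> 2 \<Longrightarrow> \<bar>g (z + w) - g z\<bar> < \<epsilon> / 2"
      using lq_hess_ratio_slowly_varying[of "\<epsilon> / 2" j] unfolding g_def by blast
    have N1: "?N e = 1" "?N e' = 1" by (simp_all add: e_def e'_def lq_norm_axis)
    have \<Delta>: "\<bar>\<Delta> (z + w) - g z\<bar> < \<epsilon> / 2" if z: "?N z > R" and w: "?N w \<le> 1" for z w
    proof -
      have "?N (z + w) > 1" using reverse_triangle[of z "z + w"] z w R(1) by simp
      then obtain s t where st: "\<bar>s\<bar> \<le> 1" "\<bar>t\<bar> \<le> 1"
        "\<Delta> (z + w) = g (z + w + s *\<^sub>R e) / 2 + g (z + w + t *\<^sub>R e) / 2"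
        unfolding \<Delta>_def g_def e_def by (rule lq_norm_sq_second_difference)
      have "\<bar>g (z + w + r *\<^sub>R e) - g z\<bar> < \<epsilon> / 2" if "\<bar>r\<bar> \<le> 1" for r
        using R(2)[OF z, of "w + r *\<^sub>R e"] triangle[of w "r *\<^sub>R e"] that w N1 by (simp add: scale add.assoc)
      from this[OF st(1)] this[OF st(2)] show ?thesis unfolding st(3) by linarith
    qed
    obtain c where c: "c > 0" "\<And>x. c * norm x \<le> ?N x" using norm_le by blast
    have "dist (\<Delta> z - \<Delta> (z + e')) 0 < \<epsilon>" if "(R + 1) / c \<le> norm z" for z
    proof -
      have "R + 1 \<le> c * norm z" using that c(1) by (simp add: field_simps)
      then have "?N z > R" using c(2)[of z] by linarith
      then have "\<bar>\<Delta> z - g z\<bar> < \<epsilon> / 2" "\<bar>\<Delta> (z + e') - g z\<bar> < \<epsilon> / 2"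
        using \<Delta>[of z 0] \<Delta>[of z e'] N1 by simp_all
      then have "\<bar>\<Delta> z - \<Delta> (z + e')\<bar> < \<epsilon>" by linarith
      then show ?thesis by simp
    qed
    then show "\<forall>\<^sub>F z in at_infinity. dist (\<Delta> z - \<Delta> (z + e')) 0 < \<epsilon>"
      unfolding eventually_at_infinity by blast
  qed
  have sum_axes: "?N (e' + s *\<^sub>R e) = 2 powr (1 / q)" if "\<bar>s\<bar> = 1" for s
  proof -
    have "(\<Sum>k\<in>UNIV. \<bar>(e' + s *\<^sub>R e) $ k\<bar> powr q) = (\<Sum>k\<in>UNIV. (if k = i then 1 else 0) + (if k = j then 1 else 0))"
      using q ij that by (intro sum.cong) (auto simp: axis_def e_def e'_def)
    then show ?thesis unfolding lq_norm_def by (simp add: sum.distrib)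
  qed
  have "?N (e' + e) = 2 powr (1 / q)" "?N (e' - e) = 2 powr (1 / q)"
    using sum_axes[of 1] sum_axes[of "-1"] by simp_all
  \<comment> \<open>\<open>\<Delta> 0\<close> is 2 and \<open>\<Delta> e'\<close> is
    \<open>2 * (2 powr (1 / q))\<^sup>2 - 2\<close>. The difference would vanish at
    \<open>q = 2\<close>, the Euclidean case, and is positive for \<open>q > 2\<close>.\<close>
  then have "\<Delta> 0 - \<Delta> (0 + e') = 4 - 2 * (2 powr (1 / q))\<^sup>2"
    by (simp add: \<Delta>_def) (simp add: e_def e'_def lq_norm_axis)
  moreover have "(2 powr (1 / q))\<^sup>2 < (2::real)"
  proof -
    have "(2 powr (1 / q))\<^sup>2 = (2::real) powr (2 / q)" by (simp add: power2_eq_square powr_add[symmetric])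
    also have "\<dots> < 2 powr 1" using q by (intro powr_less_mono) auto
    finally show ?thesis by simp
  qed
  ultimately have "\<Delta> 0 - \<Delta> (0 + e') \<noteq> 0" by simp
  then have nz: "(\<Sum>(c, w)\<leftarrow>cs. c * (?N (0 + w))\<^sup>2) \<noteq> 0" unfolding K .
  have "isometrically_rigid 2 UNIV (\<lambda>x y. ?N (x - y))"
    by (rule isometrically_rigid_if_atoms_determined, rule measure_singleton_eqI[OF _ _ _ lim nz])
  moreover have "lq_dist q = (\<lambda>x y. ?N (x - y))" by (intro ext) (simp add: lq_dist_def)
  ultimately show ?thesis by simp
qed

end

theorem theorem1p2:
  fixes q :: real
  assumes "q > 2" and "CARD('n::finite) \<ge> 2"
  shows "isometrically_rigid 2 UNIV (lq_dist q :: real ^ 'n \<Rightarrow> real ^ 'n \<Rightarrow> real)"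
  using assms by (rule isometrically_rigid_lq)

end
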